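(* Let $d\ge2$, $k\ge1$, $\beta\in[0,1]$, let $\kappa_1,\dots,\kappa_k>0$ be concentration parameters and $\alpha_1,\dots,\alpha_k\ge0$ with $\sum_i\alpha_i=1$ mixture weights, and let $d_1$ be a pseudo-metric on $\mathbb{R}$. Then $\mathrm{MSSFG}(\cdot,\cdot;\beta,\{\kappa_i\},\{\alpha_i\})$ is a pseudo-metric on $\mathcal{P}(\mathbb{R}^d)$: it is non-negative, symmetric, and there is a constant $C'>0$ with $\mathrm{MSSFG}(\mu,\xi)\le C'[\mathrm{MSSFG}(\mu,\nu)+\mathrm{MSSFG}(\nu,\xi)]$ for all $\mu,\nu,\xi\in\mathcal{P}(\mathbb{R}^d)$.
   Context: $\mathcal{P}(\mathbb{R}^d)$: probability measures on $\mathbb{R}^d$ with finite moments. A pseudo-metric $d_1$ on $\mathbb{R}$ is non-negative, symmetric, and satisfies $d_1(x,z)\le C[d_1(x,y)+d_1(y,z)]$ for a universal $C>0$. $\mathbb{S}^{d-1}$ is the unit sphere; $\theta\sharp\mu$ is the pushforward of $\mu$ under $x\mapsto\theta^\top x$. For probability measures $\rho,\eta$ on $\mathbb{R}$ with coupling set $\Pi(\rho,\eta)$, $D_{fgw}(\rho,\eta;\beta,d_1)=\min_{\pi\in\Pi(\rho,\eta)}\Big\{(1-\beta)\int d_1(s,t)\,d\pi+\beta\iint[d_1(s,s')-d_1(t,t')]^2d\pi(s,t)d\pi(s',t')\Big\}$. $\mathrm{vMF}(\cdot\mid\epsilon,\kappa)$ has density $C_d(\kappa)\exp(\kappa\epsilon^\top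 x)$ w.r.t. surface measure on $\mathbb{S}^{d-1}$, $C_d(\kappa)=\kappa^{d/2-1}/((2\pi)^{d/2}I_{d/2-1}(\kappa))$. The mixture $\mathrm{MovMF}(\cdot\mid\epsilon_{1:k},\kappa_{1:k},\alpha_{1:k})=\sum_{i=1}^k\alpha_i\mathrm{vMF}(\cdot\mid\epsilon_i,\kappa_i)$, and $\mathrm{MSSFG}(\mu,\nu;\beta,\{\kappa_i\},\{\alpha_i\})=\max_{\epsilon_1,\dots,\epsilon_k\in\mathbb{S}^{d-1}}\mathbb{E}_{\theta\sim\mathrm{MovMF}(\cdot\mid\epsilon_{1:k},\kappa_{1:k},\alpha_{1:k})}[D_{fgw}(\theta\sharp\mu,\theta\sharp\nu;\beta,d_1)]$. *)

theory Defs
  imports "HOL-Probability.Probability"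
begin

definition pseudo_metric :: "(real \<Rightarrow> real \<Rightarrow> real) \<Rightarrow> bool" where
  "pseudo_metric d1 \<longleftrightarrow>
     (\<forall>x y. 0 \<le> d1 x y) \<and> (\<forall>x y. d1 x y = d1 y x) \<and>
     (\<exists>C>0. \<forall>x y z. d1 x z \<le> C * (d1 x y + d1 y z))"

definition prob_fin_moments :: "('a::euclidean_space) measure set" where
  "prob_fin_moments = {\<mu>. prob_space \<mu> \<and> sets \<mu> = sets borel \<and>
       (\<forall>p::nat. integrable \<mu> (\<lambda>x. norm x ^ p))}"

definition couplings :: "real measure \<Rightarrow> real measure \<Rightarrow> (real \<times> real) measure set" where
  "couplings \<rho> \<eta> = {\<pi>. prob_space \<pi> \<and> sets \<pi> = sets borel \<and>
       distr \<pi> borel fst = \<rho> \<and> distr \<pi> borel snd = \<eta>}"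

definition D_fgw :: "real \<Rightarrow> (real \<Rightarrow> real \<Rightarrow> real) \<Rightarrow> real measure \<Rightarrow> real measure \<Rightarrow> ennreal" where
  "D_fgw \<beta> d1 \<rho> \<eta> =
     (INF \<pi> \<in> couplings \<rho> \<eta>.
        ennreal (1 - \<beta>) * (\<integral>\<^sup>+ p. ennreal (d1 (fst p) (snd p)) \<partial>\<pi>)
      + ennreal \<beta> * (\<integral>\<^sup>+ p. \<integral>\<^sup>+ q. ennreal ((d1 (fst p) (fst q) - d1 (snd p) (snd q))\<^sup>2) \<partial>\<pi> \<partial>\<pi>))"

definition proj_push :: "'a::euclidean_space \<Rightarrow> 'a measure \<Rightarrow> real measure" where
  "proj_push \<theta> \<mu> = distr \<mu> borel (\<lambda>x. \<theta> \<bullet> x)"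

(* Normalized (uniform) surface measure on the unit sphere S^{d-1}: radial projection of
  the uniform distribution on the unit ball.  It is a constant multiple of the surface measure. *)
definition sphere_unif :: "'a::euclidean_space measure" where
  "sphere_unif = distr (uniform_measure lborel (ball 0 1)) borel (\<lambda>x. x /\<^sub>R norm x)"

(* von Mises-Fisher density on the sphere (w.r.t. sphere_unif), normalized to a probability
  density; this is C_d(\<kappa>) exp(\<kappa> \<epsilon>^T x) w.r.t. the surface measure. *)
definition vmf_density :: "real \<Rightarrow> 'a::euclidean_space \<Rightarrow> 'a \<Rightarrow> real" where
  "vmf_density \<kappa> \<epsilon> x =
     exp (\<kappa> * (\<epsilon> \<bullet> x)) / (\<integral> y. exp (\<kappa> * (\<epsilon> \<bullet> y)) \<partial>sphere_unif)"

definition movmf :: "nat \<Rightarrow> (nat \<Rightarrow> real) \<Rightarrow> (nat \<Rightarrow> real) \<Rightarrow> (nat \<Rightarrow> 'a::euclidean_space) \<Rightarrow> 'a measure" where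
  "movmf k \<kappa> \<alpha> \<epsilon> =
     density sphere_unif (\<lambda>x. ennreal (\<Sum>i<k. \<alpha> i * vmf_density (\<kappa> i) (\<epsilon> i) x))"

definition MSSFG :: "real \<Rightarrow> (real \<Rightarrow> real \<Rightarrow> real) \<Rightarrow> nat \<Rightarrow> (nat \<Rightarrow> real) \<Rightarrow> (nat \<Rightarrow> real)
                      \<Rightarrow> 'a::euclidean_space measure \<Rightarrow> 'a measure \<Rightarrow> ennreal" where
  "MSSFG \<beta> d1 k \<kappa> \<alpha> \<mu> \<nu> =
     (SUP \<epsilon> \<in> {\<epsilon>. \<forall>i<k. \<epsilon> i \<in> sphere 0 1}.
        \<integral>\<^sup>+ \<theta>. D_fgw \<beta> d1 (proj_push \<theta> \<mu>) (proj_push \<theta> \<nu>) \<partial>(movmf k \<kappa> \<alpha> \<epsilon>))"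

end

theory Submission
  imports Defs
begin

text \<open>
  For a fixed direction \<open>\<theta>\<close>, gluing two couplings along their common marginal gives
  \<open>D_fgw(\<rho>, \<zeta>) \<le> max C 2 * (D_fgw(\<rho>, \<eta>) + D_fgw(\<eta>, \<zeta>))\<close>, using the relaxed triangle inequality of
  \<open>d1\<close> for the linear part and \<open>(a - c)\<^sup>2 \<le> 2 (a - b)\<^sup>2 + 2 (b - c)\<^sup>2\<close> for the quadratic part.

  Integrating this over \<open>\<theta>\<close> needs measurability of \<open>\<theta> \<mapsto> D_fgw (\<theta>\<sharp>\<mu>) (\<theta>\<sharp>\<nu>)\<close>: the
  integral of a nonmeasurable function is a lower integral, which is not subadditive.
  As \<open>d1\<close> is merely Borel, this infimum over an uncountable set of couplings need not be a
  Borel function. But all probability measures on the plane are parametrised by a single real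
  \<open>r \<in> [0, 2]\<close>, through a code for the values of a distribution function at the rationals.
  The cost and the marginal constraints are Borel in \<open>(\<theta>, r)\<close>, so the sublevel sets of the
  infimum are projections of Borel sets; these are analytic, hence measurable for the
  completion of every finite measure by Choquet's capacity argument.
\<close>

section \<open>Analytic sets and measurable projection\<close>

text \<open>Over a Polish space these are the Souslin sets. Writing them as projections of closed
  sets along Baire space covers the empty set and supplies the witnessing sequences that are
  truncated later.\<close>

definition analytic_set :: "'a::topological_space set \<Rightarrow> bool" where
  "analytic_set A \<longleftrightarrow> (\<exists>C :: ('a \<times> (nat \<Rightarrow> nat)) set. closed C \<and> A = fst ` C)"

lemma analytic_set_closed: "closed A \<Longrightarrow> analytic_set A"
  unfolding analytic_set_def
  by (intro exI[of _ "A \<times> UNIV"]) (auto intro: closed_Times)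

text \<open>Entry 0 of the new witness names the index \<open>i\<close>; the shifted sequence is the
  witness for \<open>A i\<close>.\<close>

lemma analytic_set_UN:
  fixes A :: "nat \<Rightarrow> 'a::topological_space set"
  assumes "\<And>i. analytic_set (A i)"
  shows "analytic_set (\<Union>i. A i)"
proof -
  obtain C :: "nat \<Rightarrow> ('a \<times> (nat \<Rightarrow> nat)) set"
    where C: "\<And>i. closed (C i)" "\<And>i. A i = fst ` C i"
    using assms unfolding analytic_set_def by metis
  define E where "E = {p :: 'a \<times> (nat \<Rightarrow> nat). (fst p, \<lambda>j. snd p (Suc j)) \<in> C (snd p 0)}"
  have cont: "continuous_on UNIV (\<lambda>p :: 'a \<times> (nat \<Rightarrow> nat). (fst p, \<lambda>j. snd p (Suc j)))"
    by (intro continuous_intros continuous_on_coordinatewise_then_product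
          continuous_on_compose2[OF continuous_on_product_coordinates continuous_on_snd]) auto
  have cont0: "continuous_on UNIV (\<lambda>p :: 'a \<times> (nat \<Rightarrow> nat). snd p 0)"
    by (intro continuous_on_compose2[OF continuous_on_product_coordinates continuous_on_snd]
          continuous_intros) auto
  \<comment> \<open>The implication "entry 0 equals \<open>i\<close>, hence the shifted pair lies in
    \<open>C i\<close>" is a union of two closed sets, because a condition on one discrete entry is
    clopen.\<close>
  have "E = (\<Inter>i. (\<lambda>p. snd p 0) -` (- {i}) \<union>
      (\<lambda>p. (fst p, \<lambda>j. snd p (Suc j))) -` C i)"
    by (auto simp: E_def)
  moreover have "closed ((\<lambda>p :: 'a \<times> (nat \<Rightarrow> nat). snd p 0) -` (- {i}))" for i
    by (intro closed_vimage cont0) (simp add: closed_def discrete_topology_class.open_discrete)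
  ultimately have "closed E"
    by (auto intro!: closed_INT closed_Un closed_vimage[OF C(1) cont])
  moreover have "(\<Union>i. A i) = fst ` E"
  proof (intro equalityI subsetI)
    fix x assume "x \<in> (\<Union>i. A i)"
    then obtain i s where "(x, s) \<in> C i" using C(2) by auto
    then have "(x, case_nat i s) \<in> E" by (simp add: E_def)
    then show "x \<in> fst ` E" by force
  next
    fix x assume "x \<in> fst ` E"
    then show "x \<in> (\<Union>i. A i)" using C(2) unfolding E_def by force
  qed
  ultimately show ?thesis unfolding analytic_set_def by blast
qed

text \<open>Countably many witnesses, one for each \<open>A i\<close>, are interleaved into one
  sequence by the pairing \<open>prod_encode\<close>; each row is a continuous function of the
  whole.\<close>

lemma analytic_set_INT:
  fixes A :: "nat \<Rightarrow> 'a::topological_space set"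
  assumes "\<And>i. analytic_set (A i)"
  shows "analytic_set (\<Inter>i. A i)"
proof -
  obtain C :: "nat \<Rightarrow> ('a \<times> (nat \<Rightarrow> nat)) set"
    where C: "\<And>i. closed (C i)" "\<And>i. A i = fst ` C i"
    using assms unfolding analytic_set_def by metis
  define E where "E = (\<Inter>i. (\<lambda>p :: 'a \<times> (nat \<Rightarrow> nat).
    (fst p, \<lambda>j. snd p (prod_encode (i, j)))) -` C i)"
  have cont: "continuous_on UNIV (\<lambda>p :: 'a \<times> (nat \<Rightarrow> nat).
      (fst p, \<lambda>j. snd p (prod_encode (i, j))))" for i
    by (intro continuous_intros continuous_on_coordinatewise_then_product
          continuous_on_compose2[OF continuous_on_product_coordinates continuous_on_snd]) auto
  have "closed E"
    unfolding E_def by (auto intro!: closed_INT closed_vimage[OF C(1) cont])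
  moreover have "(\<Inter>i. A i) = fst ` E"
  proof (intro equalityI subsetI)
    fix x assume "x \<in> (\<Inter>i. A i)"
    then have "\<forall>i. \<exists>s. (x, s) \<in> C i" using C(2) by force
    then obtain s where s: "\<And>i. (x, s i) \<in> C i" by metis
    have "(x, \<lambda>k. case prod_decode k of (i, j) \<Rightarrow> s i j) \<in> E" by (simp add: E_def s)
    then show "x \<in> fst ` E" by force
  next
    fix x assume "x \<in> fst ` E"
    then show "x \<in> (\<Inter>i. A i)" using C(2) unfolding E_def by force
  qed
  ultimately show ?thesis unfolding analytic_set_def by blast
qed

text \<open>Open subsets of a Euclidean space are \<sigma>-compact, which reduces the claim to
  closed sets.\<close>

lemma analytic_set_open:
  fixes A :: "'a::euclidean_space set"
  assumes "open A"
  shows "analytic_set A"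
proof -
  obtain F :: "nat \<Rightarrow> 'a set" where "\<And>i. compact (F i)" "A = (\<Union>i. F i)"
    using open_Union_compact_subsets[OF assms] by metis
  then show ?thesis
    by (metis analytic_set_UN analytic_set_closed compact_imp_closed)
qed

text \<open>A complement of an analytic set need not be analytic, so the induction carries the claim
  for the set and for its complement together.\<close>

lemma analytic_set_borel:
  fixes A :: "'a::euclidean_space set"
  assumes "A \<in> sets borel"
  shows "analytic_set A"
proof -
  have "A \<in> sigma_sets UNIV (Collect open)"
    using assms by (simp add: borel_def)
  then have "analytic_set A \<and> analytic_set (- A)"
  proof induction
    case (Basic a)
    then show ?case by (auto intro: analytic_set_open analytic_set_closed)
  next
    case (Union a)
    then show ?case by (auto simp: Compl_UN intro: analytic_set_UN analytic_set_INT)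
  qed (auto simp: Compl_eq_Diff_UNIV[symmetric] intro: analytic_set_closed)
  then show ?thesis by simp
qed

section \<open>Capacity argument and measurable projection\<close>

lemma compact_bounded_sequences: "compact {s :: nat \<Rightarrow> nat. \<forall>i. s i \<le> b i}"
proof -
  have "compactin (product_topology (\<lambda>i. euclidean) UNIV) (PiE UNIV (\<lambda>i. {..b i}))"
    by (subst compactin_PiE) (auto simp: finite_imp_compact)
  moreover have "PiE UNIV (\<lambda>i. {..b i}) = {s :: nat \<Rightarrow> nat. \<forall>i. s i \<le> b i}"
    by (auto simp: PiE_def Pi_def)
  ultimately show ?thesis by (simp add: euclidean_product_topology)
qed

text \<open>Choquet's capacity argument: truncating the entries of the witnessing sequences one
  after another costs arbitrarily little outer measure, and after all truncations
  the projection is taken along a compact set.\<close>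

lemma outer_measure_projection_approx:
  fixes C :: "(('a::euclidean_space \<times> real) \<times> (nat \<Rightarrow> nat)) set"
  assumes C: "closed C" and fin: "finite_measure M" and sets: "sets M = sets borel"
    and bnd: "fst ` C \<subseteq> UNIV \<times> {0..2}" and c: "c < outer_measure_of M (fst ` fst ` C)"
  shows "\<exists>Q. Q \<in> sets M \<and> Q \<subseteq> fst ` fst ` C \<and> c \<le> emeasure M Q"
proof -
  interpret finite_measure M by fact
  have [simp]: "space M = UNIV" using sets_eq_imp_space_eq[OF sets] by simp
  \<comment> \<open>Only the first \<open>k\<close> entries of the witness are bounded by
    \<open>n\<close>; the later ones remain free.\<close>
  define S where "S k n = fst ` fst ` (C \<inter> UNIV \<times> {s. \<forall>i<k. s i \<le> n i})" for k and n :: "nat \<Rightarrow> nat"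
  \<comment> \<open>Letting the bound \<open>m\<close> on entry \<open>k\<close> grow exhausts
    \<open>S k n\<close>. Outer measure is continuous along increasing sequences of arbitrary sets,
    so some finite \<open>m\<close> keeps it above \<open>c\<close>.\<close>
  have step: "\<exists>m. c < outer_measure_of M (S (Suc k) (n(k := m)))"
    if "c < outer_measure_of M (S k n)" for k n
  proof -
    have "(\<Union>m. S (Suc k) (n(k := m))) = S k n"
    proof -
      have "(\<Union>m. {s :: nat \<Rightarrow> nat. \<forall>i<Suc k. s i \<le> (n(k := m)) i}) = {s. \<forall>i<k. s i \<le> n i}"
        by (auto simp: less_Suc_eq)
      then have "C \<inter> UNIV \<times> {s. \<forall>i<k. s i \<le> n i} =
          (\<Union>m. C \<inter> UNIV \<times> {s. \<forall>i<Suc k. s i \<le> (n(k := m)) i})" by blast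
      then show ?thesis unfolding S_def by (simp only: image_UN)
    qed
    moreover have "(SUP m. outer_measure_of M (S (Suc k) (n(k := m)))) =
        outer_measure_of M (\<Union>m. S (Suc k) (n(k := m)))"
    proof (rule SUP_outer_measure_of_incseq)
      show "incseq (\<lambda>m. S (Suc k) (n(k := m)))"
        unfolding incseq_def S_def
        by (intro allI impI image_mono Int_mono Sigma_mono order_refl) (auto intro: order_trans)
    qed (simp)
    ultimately have "c < (SUP m. outer_measure_of M (S (Suc k) (n(k := m))))" using that by simp
    then show ?thesis unfolding less_SUP_iff by blast
  qed
  have dep: "S k n = S k n'" if "\<And>i. i < k \<Longrightarrow> n i = n' i" for k n n'
    unfolding S_def using that by auto
  \<comment> \<open>Round \<open>k\<close> changes entry \<open>k\<close> alone, so the bounds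
    stabilise and the diagonal \<open>n\<close> below agrees with \<open>f k\<close> on the first
    \<open>k\<close> entries.\<close>
  define f where "f = rec_nat (\<lambda>_. 0 :: nat)
    (\<lambda>k n. n(k := SOME m. c < outer_measure_of M (S (Suc k) (n(k := m)))))"
  have fS: "f (Suc k) = (f k)(k := SOME m. c < outer_measure_of M (S (Suc k) ((f k)(k := m))))" for k
    unfolding f_def by (simp only: nat.rec)
  have f: "c < outer_measure_of M (S k (f k))" for k
  proof (induction k)
    case 0
    then show ?case using c by (simp add: S_def f_def)
  next
    case (Suc k)
    show ?case unfolding fS using someI_ex[OF step[OF Suc]] .
  qed
  define n where "n i = f (Suc i) i" for i
  have fn: "f (k + j) i = f k i" if "i < k" for i j k
    using that by (induction j) (auto simp: fS)
  have "S k (f k) = S k n" for k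
  proof (rule dep)
    fix i assume "i < k"
    then show "f k i = n i" unfolding n_def using fn[of i "Suc i" "k - Suc i"] by simp
  qed
  then have S: "c < outer_measure_of M (S k n)" for k using f[of k] by simp
  \<comment> \<open>The sets \<open>S k n\<close> need not be measurable. Their closures are, and
    compactness shows that the intersection of the closures still lies inside the
    projection.\<close>
  define Q where "Q k = closure (S k n)" for k
  have Qsets: "Q k \<in> sets M" for k by (simp add: Q_def sets)
  have "c \<le> emeasure M (Q k)" for k
    using S[of k] outer_measure_of_mono[of "S k n" "Q k" M] closure_subset[of "S k n"] Qsets[of k]
    by (auto simp: Q_def)
  moreover have "decseq Q"
    unfolding Q_def decseq_def S_def
    by (intro allI impI closure_mono image_mono Int_mono Sigma_mono order_refl) auto
  ultimately have "c \<le> emeasure M (\<Inter>k. Q k)"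
    using Qsets by (subst INF_emeasure_decseq[symmetric]) (auto intro: INF_greatest)
  moreover have "(\<Inter>k. Q k) \<subseteq> fst ` fst ` C"
  proof
    fix x assume x: "x \<in> (\<Inter>k. Q k)"
    have "\<exists>y z s. ((y, z), s) \<in> C \<and> (\<forall>i<k. s i \<le> n i) \<and> dist y x < 1 / Suc k" for k
    proof -
      have "x \<in> closure (S k n)" using x by (simp add: Q_def)
      then obtain y where "y \<in> S k n" "dist y x < 1 / Suc k"
        unfolding closure_approachable by (metis of_nat_0_less_iff zero_less_Suc zero_less_divide_1_iff)
      then show ?thesis unfolding S_def by fastforce
    qed
    then obtain y z s where *: "\<And>k. ((y k, z k), s k) \<in> C" "\<And>k i. i < k \<Longrightarrow> s k i \<le> n i"
      "\<And>k. dist (y k) x < 1 / Suc k" by metis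
    \<comment> \<open>The bound \<open>n\<close> controls entry \<open>i\<close> of
      \<open>s k\<close> only for \<open>i < k\<close>. The finitely many remaining
      \<open>k \<le> i\<close> are absorbed by the maximum, so \<open>b\<close> bounds every
      sequence \<open>s k\<close>.\<close>
    define b where "b i = max (n i) (Max ((\<lambda>k. s k i) ` {..i}))" for i
    have sb: "s k i \<le> b i" for k i
    proof (cases "i < k")
      case False
      then have "s k i \<le> Max ((\<lambda>k. s k i) ` {..i})" by (intro Max_ge) auto
      then show ?thesis by (simp add: b_def)
    qed (use * in \<open>simp add: b_def le_max_iff_disj\<close>)
    \<comment> \<open>Both hidden coordinates now range over compact sets, so a subsequence of the
      witnesses converges; closedness of \<open>C\<close> then puts \<open>x\<close> into the
      projection.\<close>
    have "compact ({0..2::real} \<times> {s :: nat \<Rightarrow> nat. \<forall>i. s i \<le> b i})"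
      by (intro compact_Times compact_bounded_sequences compact_Icc)
    then have sc: "seq_compact ({0..2::real} \<times> {s :: nat \<Rightarrow> nat. \<forall>i. s i \<le> b i})"
      by (rule compact_imp_seq_compact)
    have zs: "(z k, s k) \<in> {0..2} \<times> {s. \<forall>i. s i \<le> b i}" for k
    proof -
      have "(y k, z k) \<in> fst ` C" using *(1)[of k] by (rule rev_image_eqI) simp
      then show ?thesis using bnd sb by auto
    qed
    obtain l r where l: "strict_mono r" "((\<lambda>k. (z k, s k)) \<circ> r) \<longlonglongrightarrow> l"
      by (rule seq_compactE[OF sc, of "\<lambda>k. (z k, s k)"]) (use zs in blast)+
    have "y \<longlonglongrightarrow> x"
    proof (rule metric_tendsto_imp_tendsto)
      show "(\<lambda>k. 1 / real (Suc k)) \<longlonglongrightarrow> 0" by (rule LIMSEQ_Suc[OF lim_1_over_n])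
      show "\<forall>\<^sub>F k in sequentially. dist (y k) x \<le> dist (1 / real (Suc k)) 0"
        using *(3) by (simp add: less_imp_le)
    qed
    then have "(y \<circ> r) \<longlonglongrightarrow> x" using l(1) by (rule LIMSEQ_subseq_LIMSEQ)
    then have "(\<lambda>k. ((y (r k), z (r k)), s (r k))) \<longlonglongrightarrow> ((x, fst l), snd l)"
      using tendsto_fst[OF l(2)] tendsto_snd[OF l(2)] by (auto intro!: tendsto_Pair simp: o_def)
    then have "((x, fst l), snd l) \<in> C"
      by (rule closed_sequentially[OF C, rotated]) (rule *(1))
    then show "x \<in> fst ` fst ` C" by (intro rev_image_eqI[of "(x, fst l)"] rev_image_eqI[of "((x, fst l), snd l)"]) auto
  qed
  moreover have "(\<Inter>k. Q k) \<in> sets M" using Qsets by auto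
  ultimately show ?thesis by blast
qed

text \<open>The projection lies between a measurable hull \<open>H\<close> of equal outer measure
  and a countable union of measurable subsets \<open>L i\<close> whose measures approach that of
  \<open>H\<close>. The gap is a null set.\<close>

lemma measurable_projection:
  fixes B :: "('a::euclidean_space \<times> real) set"
  assumes B: "B \<in> sets borel" "B \<subseteq> UNIV \<times> {0..2}"
    and fin: "finite_measure M" and sets: "sets M = sets borel"
  shows "fst ` B \<in> sets (completion M)"
proof -
  interpret finite_measure M by fact
  have sp: "space M = UNIV" using sets_eq_imp_space_eq[OF sets] by simp
  obtain C :: "(('a \<times> real) \<times> (nat \<Rightarrow> nat)) set" where C: "closed C" "B = fst ` C"
    using analytic_set_borel[OF B(1)] unfolding analytic_set_def by blast
  let ?P = "fst ` B"
  obtain H where H: "H \<in> sets M" "?P \<subseteq> H" "outer_measure_of M ?P = emeasure M H"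
    using outer_measure_of_attain[of ?P M] sp by auto
  have "\<exists>L. L \<in> sets M \<and> L \<subseteq> ?P \<and> measure M H - 1 / Suc i \<le> measure M L" for i
  proof (cases "measure M H - 1 / Suc i < 0")
    \<comment> \<open>\<open>ennreal\<close> would truncate the negative level to 0, and the strict
      inequality required for the approximation can fail there; the empty set serves
      instead.\<close>
    case True
    then show ?thesis by (intro exI[of _ "{}"]) auto
  next
    case False
    then have "ennreal (measure M H - 1 / Suc i) < outer_measure_of M (fst ` fst ` C)"
      using H(3) C(2) by (simp add: emeasure_eq_measure ennreal_less_iff)
    from outer_measure_projection_approx[OF C(1) fin sets _ this] B(2) C(2)
    show ?thesis by (auto simp: emeasure_eq_measure)
  qed
  then obtain L where L: "\<And>i. L i \<in> sets M" "\<And>i. L i \<subseteq> ?P"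
      "\<And>i. measure M H - 1 / Suc i \<le> measure M (L i)" by metis
  have LU: "(\<Union>i. L i) \<in> sets M" "(\<Union>i. L i) \<subseteq> H" using L(1,2) H(2) by blast+
  have "measure M H \<le> measure M (\<Union>i. L i)"
  proof (rule field_le_epsilon)
    fix e :: real assume "0 < e"
    then obtain i where "1 / Suc i < e" using reals_Archimedean by (auto simp: inverse_eq_divide)
    moreover have "measure M (L i) \<le> measure M (\<Union>i. L i)"
      using LU by (intro finite_measure_mono) auto
    ultimately show "measure M H \<le> measure M (\<Union>i. L i) + e" using L(3)[of i] by linarith
  qed
  then have "measure M (H - (\<Union>i. L i)) = 0"
    using finite_measure_Diff[OF H(1) LU] measure_nonneg[of M "H - (\<Union>i. L i)"] by linarith
  then have "H - (\<Union>i. L i) \<in> null_sets M"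
    using H LU by (auto simp: null_sets_def emeasure_eq_measure)
  then show ?thesis
    by (intro sets_completionI[of _ "\<Union>i. L i" "?P - (\<Union>i. L i)" "H - (\<Union>i. L i)"])
       (use L H LU in auto)
qed

section \<open>Coding sequences of reals by reals\<close>

definition rat_enum :: "nat \<Rightarrow> real" where
  "rat_enum n = of_rat (from_nat n)"

lemma rat_enum_between:
  assumes "a < b"
  obtains n where "a < rat_enum n" "rat_enum n < b"
proof -
  obtain r where "a < of_rat r" "of_rat r < b" using of_rat_dense[OF assms] by blast
  then show thesis using that[of "to_nat r"] by (simp add: rat_enum_def)
qed

text \<open>Base 3 with digits 0 and 1 only avoids the double expansions of base 2, so the digits
  can be recovered.\<close>

definition ternary_sum :: "(nat \<Rightarrow> bool) \<Rightarrow> real" where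
  "ternary_sum b = (\<Sum>n. (if b n then 1 else 0) / 3 ^ n)"

definition ternary_shift :: "real \<Rightarrow> real" where
  "ternary_shift r = 3 * (r - (if 1 \<le> r then 1 else 0))"

definition ternary_bit :: "real \<Rightarrow> nat \<Rightarrow> bool" where
  "ternary_bit r n \<longleftrightarrow> 1 \<le> (ternary_shift ^^ n) r"

lemma summable_ternary: "summable (\<lambda>n. (if b n then 1 else 0) / 3 ^ n :: real)"
  by (rule summable_comparison_test'[of "\<lambda>n. (1/3) ^ n"])
     (auto intro!: summable_geometric simp: power_one_over[symmetric])

lemma ternary_sum_bounds: "0 \<le> ternary_sum b" "ternary_sum b \<le> 3 / 2"
proof -
  show "0 \<le> ternary_sum b" unfolding ternary_sum_def
    by (intro suminf_nonneg summable_ternary) auto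
  have "ternary_sum b \<le> (\<Sum>n. (1/3) ^ n)" unfolding ternary_sum_def
    by (intro suminf_le summable_ternary summable_geometric) (auto simp: power_one_over)
  also have "\<dots> = 3 / 2" by (subst suminf_geometric) auto
  finally show "ternary_sum b \<le> 3 / 2" .
qed

lemma ternary_sum_rec:
  "ternary_sum b = (if b 0 then 1 else 0) + ternary_sum (\<lambda>n. b (Suc n)) / 3"
proof -
  have "(\<Sum>n. (if b (Suc n) then 1 else 0) / 3 ^ Suc n :: real) =
      ternary_sum (\<lambda>n. b (Suc n)) / 3"
    unfolding ternary_sum_def
    using suminf_divide[OF summable_ternary[of "\<lambda>n. b (Suc n)"], of 3] by (simp add: mult.commute)
  then show ?thesis
    using suminf_split_head[OF summable_ternary[of b]] by (simp add: ternary_sum_def)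
qed

text \<open>All digits after the leading one contribute at most 1/2 in total, so comparison with 1
  reads off the leading digit.\<close>

lemma ternary_shift_sum: "ternary_shift (ternary_sum b) = ternary_sum (\<lambda>n. b (Suc n))"
  and ternary_sum_ge_1: "1 \<le> ternary_sum b \<longleftrightarrow> b 0"
  using ternary_sum_bounds[of "\<lambda>n. b (Suc n)"] ternary_sum_rec[of b]
  by (auto simp: ternary_shift_def)

lemma ternary_bit_sum: "ternary_bit (ternary_sum b) n = b n"
proof -
  have "(ternary_shift ^^ n) (ternary_sum b) = ternary_sum (\<lambda>i. b (i + n))"
    by (induction n) (simp_all add: ternary_shift_sum)
  then show ?thesis by (simp add: ternary_bit_def ternary_sum_ge_1)
qed

lemma measurable_ternary_bit[measurable]: "Measurable.pred borel (\<lambda>r. ternary_bit r n)"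
proof -
  have [measurable]: "ternary_shift \<in> borel_measurable borel"
    unfolding ternary_shift_def by measurable
  have [measurable]: "ternary_shift ^^ n \<in> borel_measurable borel" for n
    by (induction n) auto
  show ?thesis unfolding ternary_bit_def by measurable
qed

text \<open>The real with upper rational cut \<open>b\<close>; the junk value is \<open>0\<close> for an empty or full cut.\<close>

definition cut_real :: "(nat \<Rightarrow> bool) \<Rightarrow> real" where
  "cut_real b = real_of_ereal (INF n. if b n then ereal (rat_enum n) else \<infinity>)"

lemma cut_real_eq: "cut_real (\<lambda>n. x < rat_enum n) = x"
proof -
  have "(INF n. if x < rat_enum n then ereal (rat_enum n) else \<infinity>) = ereal x"
  proof (rule antisym)
    show "(INF n. if x < rat_enum n then ereal (rat_enum n) else \<infinity>) \<le> ereal x"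
    proof (rule ereal_le_epsilon2)
      fix e :: real assume "0 < e"
      then obtain n where n: "x < rat_enum n" "rat_enum n < x + e"
        using rat_enum_between[of x "x + e"] by auto
      then show "(INF n. if x < rat_enum n then ereal (rat_enum n) else \<infinity>) \<le> ereal x + ereal e"
        by (intro INF_lower2[of n]) auto
    qed
  qed (rule INF_greatest, simp)
  then show ?thesis by (simp add: cut_real_def)
qed

lemma measurable_cut_real[measurable]:
  assumes [measurable]: "\<And>n. Measurable.pred M (P n)"
  shows "(\<lambda>x. cut_real (\<lambda>n. P n x)) \<in> borel_measurable M"
  unfolding cut_real_def by measurable

text \<open>Each real is stored as its upper rational cut; the countably many cuts are interleaved
  into one digit sequence.\<close>

definition seq_encode :: "(nat \<Rightarrow> real) \<Rightarrow> real" where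
  "seq_encode z = ternary_sum (\<lambda>k. case prod_decode k of (n, m) \<Rightarrow> z n < rat_enum m)"

definition seq_decode :: "real \<Rightarrow> nat \<Rightarrow> real" where
  "seq_decode r n = cut_real (\<lambda>m. ternary_bit r (prod_encode (n, m)))"

lemma seq_decode_encode: "seq_decode (seq_encode z) n = z n"
  by (simp add: seq_decode_def seq_encode_def ternary_bit_sum cut_real_eq)

text \<open>Confining the codes to a compact interval is what makes
  \<open>measurable_projection\<close> applicable.\<close>

lemma seq_encode_bounds: "seq_encode z \<in> {0..2}"
  by (auto simp: seq_encode_def ternary_sum_bounds intro: order_trans[OF ternary_sum_bounds(2)])

lemma measurable_seq_decode[measurable]: "(\<lambda>r. seq_decode r n) \<in> borel_measurable borel"
  unfolding seq_decode_def by measurable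

lemma measurable_seq_encode:
  assumes [measurable]: "\<And>n. z n \<in> borel_measurable M"
  shows "(\<lambda>x. seq_encode (\<lambda>n. z n x)) \<in> borel_measurable M"
  unfolding seq_encode_def ternary_sum_def split_beta by measurable

section \<open>Quantile representation of measures on the plane\<close>

definition unit_unif :: "real measure" where
  "unit_unif = uniform_measure lborel {0..1}"

lemma sets_unit_unif[simp, measurable_cong]: "sets unit_unif = sets borel"
  by (simp add: unit_unif_def)

lemma space_unit_unif[simp]: "space unit_unif = UNIV"
  by (simp add: unit_unif_def)

lemma prob_space_unit_unif: "prob_space unit_unif"
  unfolding unit_unif_def by (rule prob_space_uniform_measure) auto

lemma emeasure_unit_unif_atMost:
  assumes "0 \<le> x" "x \<le> 1"
  shows "emeasure unit_unif {..x} = ennreal x"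
proof -
  have "{0..1} \<inter> {..x} = {0..x}" using assms by auto
  then show ?thesis using assms by (simp add: unit_unif_def divide_ennreal_def)
qed

text \<open>Tested on the set where \<open>g < f\<close>, the hypothesis forces the integral of
  \<open>f - g\<close> there to vanish; finiteness of the integral of \<open>f\<close> justifies the
  subtraction.\<close>

lemma AE_le_of_density_le:
  assumes [measurable]: "f \<in> borel_measurable M" "g \<in> borel_measurable M"
    and fin: "(\<integral>\<^sup>+x. f x \<partial>M) < \<infinity>"
    and le: "\<And>A. A \<in> sets M \<Longrightarrow> emeasure (density M f) A \<le> emeasure (density M g) A"
  shows "AE x in M. f x \<le> (g x :: ennreal)"
proof -
  define A where "A = {x \<in> space M. g x < f x}"
  have [measurable]: "A \<in> sets M" unfolding A_def by measurable
  have gf: "(\<integral>\<^sup>+x. g x * indicator A x \<partial>M) \<le> (\<integral>\<^sup>+x. f x * indicator A x \<partial>M)"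
    by (intro nn_integral_mono) (auto simp: A_def indicator_def)
  have "(\<integral>\<^sup>+x. f x * indicator A x \<partial>M) \<le> (\<integral>\<^sup>+x. f x \<partial>M)"
    by (intro nn_integral_mono) (auto simp: indicator_def)
  then have fA: "(\<integral>\<^sup>+x. f x * indicator A x \<partial>M) < \<infinity>" using fin by (rule le_less_trans)
  with gf have fin': "(\<integral>\<^sup>+x. g x * indicator A x \<partial>M) \<noteq> \<infinity>" by (auto simp: top_unique)
  have "(\<integral>\<^sup>+x. f x * indicator A x - g x * indicator A x \<partial>M) =
      (\<integral>\<^sup>+x. f x * indicator A x \<partial>M) - (\<integral>\<^sup>+x. g x * indicator A x \<partial>M)"
    by (intro nn_integral_diff fin') (auto simp: A_def indicator_def)
  also have "\<dots> = 0"
    using le[of A] fA by (intro diff_eq_0_ennreal) (auto simp: emeasure_density)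
  finally have "AE x in M. f x * indicator A x - g x * indicator A x = 0"
    by (subst (asm) nn_integral_0_iff_AE) auto
  then show ?thesis
  proof (rule AE_mp, intro AE_I2 impI)
    fix x assume "x \<in> space M" "f x * indicator A x - g x * indicator A x = 0"
    then show "f x \<le> g x"
      using diff_gr0_ennreal[of "g x" "f x"] by (cases "x \<in> A") (auto simp: A_def not_less)
  qed
qed

text \<open>One rational is taken from each of the consecutive gaps between
  \<open>a - 1 / (i + 1)\<close> and \<open>a - 1 / (i + 2)\<close>. Closed rational half-lines
  thereby exhaust \<open>{..<a}\<close> monotonically.\<close>

lemma rat_enum_incseq_below:
  obtains k :: "nat \<Rightarrow> nat" where "incseq (\<lambda>i. rat_enum (k i))" "\<And>i. rat_enum (k i) < a"
    "\<And>x. x < a \<Longrightarrow> \<exists>i. x \<le> rat_enum (k i)"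
proof -
  have "\<exists>n. a - 1 / real (Suc i) < rat_enum n \<and> rat_enum n < a - 1 / real (Suc (Suc i))" for i
    using rat_enum_between[of "a - 1 / real (Suc i)" "a - 1 / real (Suc (Suc i))"]
    by (auto simp: field_simps)
  then obtain k where k: "\<And>i. a - 1 / real (Suc i) < rat_enum (k i)"
      "\<And>i. rat_enum (k i) < a - 1 / real (Suc (Suc i))" by metis
  show thesis
  proof
    show "incseq (\<lambda>i. rat_enum (k i))"
      using k by (intro incseq_SucI) (meson less_imp_le less_trans)
    show "rat_enum (k i) < a" for i using k(2)[of i] by (rule less_trans) simp
    fix x assume "x < a"
    then obtain i where "inverse (real (Suc i)) < a - x" using reals_Archimedean[of "a - x"] by auto
    then show "\<exists>i. x \<le> rat_enum (k i)" using k(1)[of i]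
      by (intro exI[of _ i]) (simp add: inverse_eq_divide)
  qed
qed

lemma measure_eqI_lessThan_pair:
  fixes M N :: "(real \<times> real) measure"
  assumes sets: "sets M = sets borel" "sets N = sets borel" and fin: "finite_measure M"
    and eq: "\<And>x y. emeasure M ({..<x} \<times> {..<y}) = emeasure N ({..<x} \<times> {..<y})"
  shows "M = N"
proof -
  interpret finite_measure M by fact
  let ?E = "range (\<lambda>p :: real \<times> real. {..<fst p} \<times> {..<snd p})"
  have "{x. eucl_less x a} = {..<fst a} \<times> {..<snd a}" for a :: "real \<times> real"
    by (cases a) (auto simp: eucl_less_def Basis_prod_def)
  then have bor: "sets borel = sigma_sets UNIV ?E"
    by (subst borel_eq_lessThan) simp
  show ?thesis
  proof (rule measure_eqI_generator_eq[of ?E UNIV M N "\<lambda>i. {..<real i} \<times> {..<real i}"])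
    show "Int_stable ?E"
    proof (rule Int_stableI)
      fix a b assume "a \<in> ?E" "b \<in> ?E"
      then obtain p q where "a = {..<fst p} \<times> {..<snd p}" "b = {..<fst q} \<times> {..<snd q}" by auto
      then have "a \<inter> b = {..<fst (min (fst p) (fst q), min (snd p) (snd q))} \<times>
          {..<snd (min (fst p) (fst q), min (snd p) (snd q))}" by auto
      then show "a \<inter> b \<in> ?E" by (rule range_eqI)
    qed
    show "range (\<lambda>i. {..<real i} \<times> {..<real i}) \<subseteq> ?E"
    proof
      fix X assume "X \<in> range (\<lambda>i. {..<real i} \<times> {..<real i})"
      then obtain i where "X = {..<fst (real i, real i)} \<times> {..<snd (real i, real i)}" by auto
      then show "X \<in> ?E" by (rule range_eqI)
    qed
    show "(\<Union>i. {..<real i} \<times> {..<real i}) = UNIV"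
    proof (intro equalityI subsetI UNIV_I)
      fix p :: "real \<times> real"
      obtain i where "max (fst p) (snd p) < real i" using reals_Archimedean2 by blast
      then show "p \<in> (\<Union>i. {..<real i} \<times> {..<real i})" by (cases p) auto
    qed
  qed (auto simp: sets bor eq[symmetric])
qed

text \<open>A disintegration of \<open>P\<close> over its first marginal, in quantile form: the Radon--Nikodym
  derivatives \<open>F n\<close> of \<open>A \<mapsto> P (A \<times> {..q})\<close>, \<open>q\<close> the \<open>n\<close>-th rational, form the conditional
  distribution function of the second coordinate.\<close>

lemma quantile_representation:
  fixes P :: "(real \<times> real) measure"
  assumes P: "prob_space P" and sets[simp, measurable_cong]: "sets P = sets borel"
  obtains F :: "nat \<Rightarrow> real \<Rightarrow> real" where "\<And>n. F n \<in> borel_measurable borel"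
    "P = distr (distr P borel fst \<Otimes>\<^sub>M unit_unif) borel
       (\<lambda>p. (fst p, cut_real (\<lambda>n. snd p \<le> F n (fst p))))"
proof -
  interpret P: prob_space P by fact
  interpret U: prob_space unit_unif by (rule prob_space_unit_unif)
  have spP[simp]: "space P = UNIV" using sets_eq_imp_space_eq[OF sets] by simp
  have mfst[measurable]: "fst \<in> P \<rightarrow>\<^sub>M borel" by (simp add: measurable_cong_sets[OF sets refl] borel_prod[symmetric])
  have msnd[measurable]: "snd \<in> P \<rightarrow>\<^sub>M borel" by (simp add: measurable_cong_sets[OF sets refl] borel_prod[symmetric])
  define H where "H = distr P borel fst"
  have setsH[simp, measurable_cong]: "sets H = sets borel" and spH[simp]: "space H = UNIV"
    by (simp_all add: H_def)
  interpret H: prob_space H unfolding H_def by (rule P.prob_space_distr) measurable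
  interpret R: pair_prob_space H unit_unif ..
  have emH: "emeasure H A = emeasure P (A \<times> UNIV)" if "A \<in> sets borel" for A
    unfolding H_def using that by (subst emeasure_distr) (auto intro!: arg_cong[where f="emeasure P"])
  define N where "N n = distr (density P (indicator (UNIV \<times> {..rat_enum n}))) borel fst" for n
  have emN: "emeasure (N n) A = emeasure P (A \<times> {..rat_enum n})" if A[measurable]: "A \<in> sets borel" for n A
  proof -
    have "emeasure (N n) A = emeasure (density P (indicator (UNIV \<times> {..rat_enum n}))) (A \<times> UNIV)"
      unfolding N_def using A by (subst emeasure_distr) (auto intro!: borel_Times arg_cong[where f="emeasure _"])
    also have "\<dots> = (\<integral>\<^sup>+x. indicator (A \<times> {..rat_enum n}) x \<partial>P)"
      using A by (subst emeasure_density) (auto intro!: nn_integral_cong borel_Times borel_measurable_indicator simp: indicator_def)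
    finally show ?thesis using A by (simp add: borel_Times)
  qed
  have [simp]: "sets (N n) = sets H" for n by (simp add: N_def)
  define G where "G n = RN_deriv H (N n)" for n
  have G[measurable]: "G n \<in> borel_measurable borel" for n
    using borel_measurable_RN_deriv[of H "N n"] by (simp add: G_def measurable_cong_sets[OF setsH refl])
  have dG: "density H (G n) = N n" for n
    unfolding G_def
  proof (rule H.density_RN_deriv)
    show "absolutely_continuous H (N n)"
      unfolding absolutely_continuous_def
    proof
      fix A assume "A \<in> null_sets H"
      then have A: "A \<in> sets borel" "emeasure P (A \<times> UNIV) = 0" by (auto simp: null_sets_def emH)
      have "emeasure P (A \<times> {..rat_enum n}) \<le> emeasure P (A \<times> UNIV)"
        using A by (intro emeasure_mono) (auto intro!: borel_Times)
      then show "A \<in> null_sets (N n)" using A by (simp add: null_sets_def emN)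
    qed
  qed simp
  have intG: "(\<integral>\<^sup>+t. G n t * indicator A t \<partial>H) = emeasure P (A \<times> {..rat_enum n})"
    if "A \<in> sets borel" for n A
    using emeasure_density[of "G n" H A] that by (simp add: dG emN)
  have finG: "(\<integral>\<^sup>+t. G n t \<partial>H) < \<infinity>" for n
    using intG[of UNIV n] by (simp add: less_top[symmetric])
  \<comment> \<open>Domination of the measures passes to their densities almost everywhere. Since
    the indices are countable, one null set serves for all bounds and all monotonicity
    relations.\<close>
  have "AE t in H. G n t \<le> 1" for n
  proof (rule AE_le_of_density_le[OF _ _ finG])
    fix A assume "A \<in> sets H"
    then show "emeasure (density H (G n)) A \<le> emeasure (density H (\<lambda>_. 1)) A"
      by (auto simp: dG emN density_1 emH intro!: emeasure_mono borel_Times)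
  qed measurable
  then have AE1: "AE t in H. \<forall>n. G n t \<le> 1" by (simp add: AE_all_countable)
  have "AE t in H. rat_enum m \<le> rat_enum n \<longrightarrow> G m t \<le> G n t" for m n
  proof (cases "rat_enum m \<le> rat_enum n")
    case True
    have "AE t in H. G m t \<le> G n t"
    proof (rule AE_le_of_density_le[OF _ _ finG])
      fix A assume "A \<in> sets H"
      then show "emeasure (density H (G m)) A \<le> emeasure (density H (G n)) A"
        using True by (auto simp: dG emN intro!: emeasure_mono borel_Times)
    qed measurable
    then show ?thesis by simp
  qed simp
  then have AE2: "AE t in H. \<forall>m n. rat_enum m \<le> rat_enum n \<longrightarrow> G m t \<le> G n t"
    by (simp add: AE_all_countable)
  \<comment> \<open>\<open>G n\<close> is bounded by 1 only almost everywhere; the truncation yields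
    a real value in the unit interval at every point.\<close>
  define F where "F n t = enn2real (min 1 (G n t))" for n t
  have F[measurable]: "F n \<in> borel_measurable borel" for n unfolding F_def by measurable
  have F01: "0 \<le> F n t" "F n t \<le> 1" for n t
    using enn2real_mono[of "min 1 (G n t)" 1] by (auto simp: F_def)
  \<comment> \<open>The conditional quantile function, kept extended-real because the infimum may be
    infinite on a null set.\<close>
  define I where "I p = (INF n. if snd p \<le> F n (fst p) then ereal (rat_enum n) else \<infinity>)" for p
  have [measurable]: "I \<in> borel_measurable (H \<Otimes>\<^sub>M unit_unif)"
    unfolding I_def by measurable
  have I_less: "I (t, u) < ereal a \<longleftrightarrow> (\<exists>n. rat_enum n < a \<and> u \<le> F n t)" for t u a
    unfolding I_def INF_less_iff by (auto split: if_splits)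
  \<comment> \<open>For almost every \<open>t\<close>, the values \<open>u\<close> with
    \<open>I (t, u) < a\<close> form an increasing union of half-lines \<open>{..F (k i) t}\<close>
    of uniform measure \<open>G (k i) t\<close>. Monotone convergence then recovers \<open>P\<close>
    on the rectangle.\<close>
  have key: "emeasure (H \<Otimes>\<^sub>M unit_unif) {p. fst p \<in> A \<and> I p < ereal a} = emeasure P (A \<times> {..<a})"
    if A[measurable]: "A \<in> sets borel" for A a
  proof -
    obtain k where k: "incseq (\<lambda>i. rat_enum (k i))" "\<And>i. rat_enum (k i) < a"
        "\<And>x. x < a \<Longrightarrow> \<exists>i. x \<le> rat_enum (k i)"
      using rat_enum_incseq_below[of a] by metis
    have meas: "{p. fst p \<in> A \<and> I p < ereal a} \<in> sets (H \<Otimes>\<^sub>M unit_unif)"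
    proof -
      have "{p \<in> space (H \<Otimes>\<^sub>M unit_unif). fst p \<in> A \<and> I p < ereal a} \<in> sets (H \<Otimes>\<^sub>M unit_unif)"
        by measurable
      then show ?thesis by (simp add: space_pair_measure)
    qed
    have "emeasure (H \<Otimes>\<^sub>M unit_unif) {p. fst p \<in> A \<and> I p < ereal a} =
        (\<integral>\<^sup>+t. emeasure unit_unif (Pair t -` {p. fst p \<in> A \<and> I p < ereal a}) \<partial>H)"
      by (rule U.emeasure_pair_measure_alt[OF meas])
    also have "\<dots> = (\<integral>\<^sup>+t. (SUP i. G (k i) t * indicator A t) \<partial>H)"
    proof (rule nn_integral_cong_AE, use AE1 AE2 in eventually_elim)
      fix t assume t: "\<forall>n. G n t \<le> 1" "\<forall>m n. rat_enum m \<le> rat_enum n \<longrightarrow> G m t \<le> G n t"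
      have FG: "ennreal (F n t) = G n t" for n
        using t(1) by (simp add: F_def min_absorb2 le_less_trans[of _ 1])
      have Fmono: "F m t \<le> F n t" if "rat_enum m \<le> rat_enum n" for m n
        using t(2) that FG F01 by (metis ennreal_le_iff)
      show "emeasure unit_unif (Pair t -` {p. fst p \<in> A \<and> I p < ereal a}) =
          (SUP i. G (k i) t * indicator A t)"
      proof (cases "t \<in> A")
        case True
        have "Pair t -` {p. fst p \<in> A \<and> I p < ereal a} = (\<Union>i. {..F (k i) t})"
          using True k(2,3) Fmono by (auto simp: I_less) (meson less_le order_trans)+
        also have "emeasure unit_unif \<dots> = (SUP i. emeasure unit_unif {..F (k i) t})"
          using Fmono k(1) by (intro SUP_emeasure_incseq[symmetric]) (auto simp: incseq_def intro: order_trans)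
        finally show ?thesis using True by (simp add: emeasure_unit_unif_atMost F01 FG)
      qed simp
    qed
    also have "\<dots> = (SUP i. \<integral>\<^sup>+t. G (k i) t * indicator A t \<partial>H)"
    proof (rule nn_integral_monotone_convergence_SUP_AE)
      show "AE t in H. G (k i) t * indicator A t \<le> G (k (Suc i)) t * indicator A t" for i
        using AE2 by eventually_elim (use incseq_SucD[OF k(1)] in \<open>auto simp: indicator_def\<close>)
    qed measurable
    also have "\<dots> = (SUP i. emeasure P (A \<times> {..rat_enum (k i)}))" by (simp add: intG)
    also have "\<dots> = emeasure P (\<Union>i. A \<times> {..rat_enum (k i)})"
      using k(1) by (intro SUP_emeasure_incseq) (auto simp: incseq_def intro!: borel_Times intro: order_trans)
    also have "(\<Union>i. A \<times> {..rat_enum (k i)}) = A \<times> {..<a}"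
      using k(2,3) by (auto intro: le_less_trans)
    finally show ?thesis .
  qed
  \<comment> \<open>\<open>real_of_ereal\<close> sends both infinities to 0, so both must be
    excluded almost everywhere: the mass of \<open>P\<close> below height \<open>k\<close> tends to
    1, and the mass below \<open>-k\<close> tends to 0.\<close>
  have "AE p in H \<Otimes>\<^sub>M unit_unif. I p \<noteq> \<infinity>"
  proof -
    have "(SUP k::nat. emeasure P (UNIV \<times> {..<real k})) = emeasure P (\<Union>k::nat. UNIV \<times> {..<real k})"
      by (intro SUP_emeasure_incseq) (auto simp: incseq_def intro!: borel_Times)
    also have "(\<Union>k::nat. UNIV \<times> {..<real k}) = (UNIV :: (real \<times> real) set)"
      using reals_Archimedean2 by auto
    finally have *: "(SUP k::nat. emeasure P (UNIV \<times> {..<real k})) = 1"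
      using P.emeasure_space_1 by simp
    have "(SUP k::nat. emeasure P (UNIV \<times> {..<real k})) \<le>
        emeasure (H \<Otimes>\<^sub>M unit_unif) {p \<in> space (H \<Otimes>\<^sub>M unit_unif). I p \<noteq> \<infinity>}"
    proof (rule SUP_least)
      fix k :: nat
      have "{p \<in> space (H \<Otimes>\<^sub>M unit_unif). I p \<noteq> \<infinity>} \<in> sets (H \<Otimes>\<^sub>M unit_unif)" by measurable
      then have "emeasure (H \<Otimes>\<^sub>M unit_unif) {p \<in> space (H \<Otimes>\<^sub>M unit_unif). I p < ereal (real k)} \<le>
          emeasure (H \<Otimes>\<^sub>M unit_unif) {p \<in> space (H \<Otimes>\<^sub>M unit_unif). I p \<noteq> \<infinity>}"
        by (intro emeasure_mono) auto
      then show "emeasure P (UNIV \<times> {..<real k}) \<le>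
          emeasure (H \<Otimes>\<^sub>M unit_unif) {p \<in> space (H \<Otimes>\<^sub>M unit_unif). I p \<noteq> \<infinity>}"
        using key[of UNIV "real k"] by (simp add: space_pair_measure)
    qed
    then have "emeasure (H \<Otimes>\<^sub>M unit_unif) {p \<in> space (H \<Otimes>\<^sub>M unit_unif). I p \<noteq> \<infinity>} = 1"
      unfolding * by (intro antisym R.emeasure_le_1)
    moreover have "{p \<in> space (H \<Otimes>\<^sub>M unit_unif). I p \<noteq> \<infinity>} \<in> sets (H \<Otimes>\<^sub>M unit_unif)" by measurable
    ultimately show ?thesis by (rule R.AE_I_eq_1)
  qed
  moreover have "AE p in H \<Otimes>\<^sub>M unit_unif. I p \<noteq> -\<infinity>"
  proof -
    have "(INF k::nat. emeasure P (UNIV \<times> {..< - real k})) = emeasure P (\<Inter>k::nat. UNIV \<times> {..< - real k})"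
      by (intro INF_emeasure_decseq) (auto simp: decseq_def intro!: borel_Times)
    also have "(\<Inter>k::nat. UNIV \<times> {..< - real k}) = ({} :: (real \<times> real) set)"
    proof -
      have "\<exists>k::nat. - real k \<le> y" for y :: real
        using real_nat_ceiling_ge[of "- y"] by (intro exI[of _ "nat \<lceil>- y\<rceil>"]) linarith
      then show ?thesis by (fastforce simp: not_less[symmetric])
    qed
    finally have *: "(INF k::nat. emeasure P (UNIV \<times> {..< - real k})) = 0" by simp
    have "emeasure (H \<Otimes>\<^sub>M unit_unif) {p \<in> space (H \<Otimes>\<^sub>M unit_unif). I p = -\<infinity>} \<le>
        (INF k::nat. emeasure P (UNIV \<times> {..< - real k}))"
    proof (rule INF_greatest)
      fix k :: nat
      have "{p \<in> space (H \<Otimes>\<^sub>M unit_unif). I p < ereal (- real k)} \<in> sets (H \<Otimes>\<^sub>M unit_unif)"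
        by measurable
      then have "emeasure (H \<Otimes>\<^sub>M unit_unif) {p \<in> space (H \<Otimes>\<^sub>M unit_unif). I p = -\<infinity>} \<le>
          emeasure (H \<Otimes>\<^sub>M unit_unif) {p \<in> space (H \<Otimes>\<^sub>M unit_unif). I p < ereal (- real k)}"
        by (intro emeasure_mono) auto
      also have "\<dots> = emeasure P (UNIV \<times> {..< - real k})"
        using key[of UNIV "- real k"] by (simp add: space_pair_measure)
      finally show "emeasure (H \<Otimes>\<^sub>M unit_unif) {p \<in> space (H \<Otimes>\<^sub>M unit_unif). I p = -\<infinity>} \<le>
          emeasure P (UNIV \<times> {..< - real k})" .
    qed
    then have "{p \<in> space (H \<Otimes>\<^sub>M unit_unif). I p = -\<infinity>} \<in> null_sets (H \<Otimes>\<^sub>M unit_unif)"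
      unfolding * by (intro null_setsI) (simp only: le_zero_eq, measurable)
    then show ?thesis by (rule AE_I') auto
  qed
  ultimately have AEI: "AE p in H \<Otimes>\<^sub>M unit_unif. ereal (real_of_ereal (I p)) = I p"
    by eventually_elim (auto simp: ereal_real)
  let ?T = "\<lambda>p. (fst p, cut_real (\<lambda>n. snd p \<le> F n (fst p)))"
  have T: "?T p = (fst p, real_of_ereal (I p))" for p by (simp add: cut_real_def I_def)
  have "P = distr (H \<Otimes>\<^sub>M unit_unif) borel (\<lambda>p. (fst p, real_of_ereal (I p)))"
  proof (rule measure_eqI_lessThan_pair)
    fix x y :: real
    have "emeasure (distr (H \<Otimes>\<^sub>M unit_unif) borel (\<lambda>p. (fst p, real_of_ereal (I p)))) ({..<x} \<times> {..<y}) =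
        emeasure (H \<Otimes>\<^sub>M unit_unif) {p \<in> space (H \<Otimes>\<^sub>M unit_unif). fst p \<in> {..<x} \<and> real_of_ereal (I p) < y}"
      by (subst emeasure_distr) (auto intro!: borel_Times arg_cong[where f="emeasure _"] simp: space_pair_measure)
    also have "\<dots> = emeasure (H \<Otimes>\<^sub>M unit_unif) {p \<in> space (H \<Otimes>\<^sub>M unit_unif). fst p \<in> {..<x} \<and> I p < ereal y}"
    proof (rule emeasure_eq_AE)
      show "AE p in H \<Otimes>\<^sub>M unit_unif.
         (p \<in> {p \<in> space (H \<Otimes>\<^sub>M unit_unif). fst p \<in> {..<x} \<and> real_of_ereal (I p) < y}) =
         (p \<in> {p \<in> space (H \<Otimes>\<^sub>M unit_unif). fst p \<in> {..<x} \<and> I p < ereal y})"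
        using AEI by eventually_elim (metis (no_types, lifting) less_ereal.simps(1) mem_Collect_eq)
    qed measurable
    also have "\<dots> = emeasure P ({..<x} \<times> {..<y})"
      using key[of "{..<x}" y] by (simp add: space_pair_measure)
    finally show "emeasure P ({..<x} \<times> {..<y}) = emeasure (distr (H \<Otimes>\<^sub>M unit_unif) borel
        (\<lambda>p. (fst p, real_of_ereal (I p)))) ({..<x} \<times> {..<y})" by simp
  qed (auto intro: P.finite_measure_axioms)
  then show thesis
    by (intro that[of F]) (auto simp: T H_def)
qed

text \<open>For a genuine code, \<open>r\<close> stores a distribution function on the line at the
  rationals, \<open>y\<close> is its quantile at \<open>u\<close>, and \<open>y\<close> in turn
  codes a point of the plane. Every other \<open>r\<close> still gives a Borel map of
  \<open>u\<close>.\<close>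

definition coded_sample :: "real \<Rightarrow> real \<Rightarrow> real \<times> real" where
  "coded_sample r u =
     (let y = cut_real (\<lambda>n. u \<le> seq_decode r n) in (seq_decode y 0, seq_decode y 1))"

lemma measurable_coded_sample[measurable]:
  "(\<lambda>p. coded_sample (fst p) (snd p)) \<in> borel \<Otimes>\<^sub>M borel \<rightarrow>\<^sub>M borel \<Otimes>\<^sub>M borel"
  unfolding coded_sample_def Let_def by measurable

definition coded_measure :: "real \<Rightarrow> (real \<times> real) measure" where
  "coded_measure r = distr unit_unif borel (coded_sample r)"

lemma measurable_coded_sample': "coded_sample r \<in> unit_unif \<rightarrow>\<^sub>M borel"
proof -
  have "(\<lambda>u. coded_sample (fst (r, u)) (snd (r, u))) \<in> unit_unif \<rightarrow>\<^sub>M borel \<Otimes>\<^sub>M borel"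
    by measurable
  then show ?thesis by (simp add: borel_prod)
qed

text \<open>The plane embeds into the line by the Borel code \<open>e\<close>. The law of
  \<open>e\<close> has a quantile representation, and decoding its samples returns
  \<open>P\<close>.\<close>

lemma ex_coded_measure:
  fixes P :: "(real \<times> real) measure"
  assumes P: "prob_space P" and sets[simp, measurable_cong]: "sets P = sets borel"
  shows "\<exists>r\<in>{0..2}. coded_measure r = P"
proof -
  interpret P: prob_space P by fact
  interpret U: prob_space unit_unif by (rule prob_space_unit_unif)
  define e where "e p = seq_encode (\<lambda>n. if n = 0 then fst p else snd p)" for p :: "real \<times> real"
  have mfst: "fst \<in> P \<rightarrow>\<^sub>M borel" "snd \<in> P \<rightarrow>\<^sub>M borel"
    by (simp_all add: measurable_cong_sets[OF sets refl] borel_prod[symmetric])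
  then have e[measurable]: "e \<in> borel_measurable P"
    unfolding e_def by (intro measurable_seq_encode) auto
  \<comment> \<open>With a constant first coordinate the disintegration has a single fibre, so the
    sequence \<open>F n 0\<close> alone describes the law of \<open>e\<close>.\<close>
  define P' where "P' = distr P borel (\<lambda>p. (0 :: real, e p))"
  have pm[measurable]: "(\<lambda>p. (0 :: real, e p)) \<in> P \<rightarrow>\<^sub>M borel"
    unfolding borel_prod[symmetric] by measurable
  have "prob_space P'" unfolding P'_def by (rule P.prob_space_distr) fact
  moreover have "sets P' = sets borel" by (simp add: P'_def)
  ultimately obtain F where F[measurable]: "\<And>n. F n \<in> borel_measurable borel"
    and P': "P' = distr (distr P' borel fst \<Otimes>\<^sub>M unit_unif) borel
       (\<lambda>p. (fst p, cut_real (\<lambda>n. snd p \<le> F n (fst p))))"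
    using quantile_representation[of P'] by blast
  have H: "distr P' borel fst = return borel 0"
  proof -
    have "distr P' borel fst = distr P borel (fst \<circ> (\<lambda>p. (0 :: real, e p)))"
      unfolding P'_def by (rule distr_distr) (use pm in \<open>auto simp: borel_prod[symmetric]\<close>)
    also have "\<dots> = return borel 0" by (simp add: o_def P.distr_const)
    finally show ?thesis .
  qed
  define r where "r = seq_encode (\<lambda>n. F n 0)"
  have dec: "(seq_decode (e p) 0, seq_decode (e p) 1) = p" for p by (simp add: e_def seq_decode_encode)
  have decm[measurable]: "(\<lambda>y. (seq_decode y 0, seq_decode y 1)) \<in> borel \<rightarrow>\<^sub>M borel"
    unfolding borel_prod[symmetric] by measurable
  have decm': "(\<lambda>q. (seq_decode (snd q) 0, seq_decode (snd q) 1)) \<in> (borel :: (real \<times> real) measure) \<rightarrow>\<^sub>M borel"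
    unfolding borel_prod[symmetric] by measurable
  have [measurable_cong]: "sets (return borel (0 :: real)) = sets borel" by simp
  have Tm: "(\<lambda>p. (fst p, cut_real (\<lambda>n. snd p \<le> F n (fst p)))) \<in> return borel 0 \<Otimes>\<^sub>M unit_unif \<rightarrow>\<^sub>M borel"
    unfolding borel_prod[symmetric] by measurable
  have "P = distr P' borel (\<lambda>q. (seq_decode (snd q) 0, seq_decode (snd q) 1))"
  proof -
    have "distr P' borel (\<lambda>q. (seq_decode (snd q) 0, seq_decode (snd q) 1)) =
        distr P borel ((\<lambda>q. (seq_decode (snd q) 0, seq_decode (snd q) 1)) \<circ> (\<lambda>p. (0 :: real, e p)))"
      unfolding P'_def by (rule distr_distr[OF decm' pm])
    also have "(\<lambda>q. (seq_decode (snd q) 0, seq_decode (snd q) 1)) \<circ> (\<lambda>p. (0 :: real, e p)) = (\<lambda>p. p)"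
      by (simp only: o_def snd_conv dec)
    finally show ?thesis by (simp add: distr_id2)
  qed
  also have "\<dots> = distr (return borel 0 \<Otimes>\<^sub>M unit_unif) borel
      (\<lambda>p. (\<lambda>y. (seq_decode y 0, seq_decode y 1)) (cut_real (\<lambda>n. snd p \<le> F n (fst p))))"
    by (subst P', unfold H, subst distr_distr[OF decm' Tm]) (simp add: o_def)
  \<comment> \<open>A product with a point mass at 0 is the image of the uniform law under
    \<open>Pair 0\<close>; this removes the dummy coordinate.\<close>
  also have "return borel 0 \<Otimes>\<^sub>M unit_unif = distr unit_unif (borel \<Otimes>\<^sub>M unit_unif) (Pair (0 :: real))"
  proof (rule measure_eqI)
    fix X assume X: "X \<in> sets (return borel (0 :: real) \<Otimes>\<^sub>M unit_unif)"
    then have [measurable]: "X \<in> sets (borel \<Otimes>\<^sub>M unit_unif)" by simp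
    have "emeasure (return borel 0 \<Otimes>\<^sub>M unit_unif) X =
        (\<integral>\<^sup>+t. emeasure unit_unif (Pair t -` X) \<partial>return borel 0)"
      by (rule U.emeasure_pair_measure_alt[OF X])
    also have "\<dots> = emeasure unit_unif (Pair 0 -` X)"
      using U.measurable_emeasure_Pair[OF X] by (intro nn_integral_return) auto
    also have "\<dots> = emeasure (distr unit_unif (borel \<Otimes>\<^sub>M unit_unif) (Pair 0)) X"
      using X by (subst emeasure_distr) auto
    finally show "emeasure (return borel 0 \<Otimes>\<^sub>M unit_unif) X =
        emeasure (distr unit_unif (borel \<Otimes>\<^sub>M unit_unif) (Pair 0)) X" .
  qed simp
  also have "distr \<dots> borel
      (\<lambda>p. (\<lambda>y. (seq_decode y 0, seq_decode y 1)) (cut_real (\<lambda>n. snd p \<le> F n (fst p)))) = coded_measure r"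
    unfolding coded_measure_def
    by (subst distr_distr)
       (auto simp: o_def coded_sample_def[abs_def] Let_def r_def seq_decode_encode borel_prod[symmetric])
  finally show ?thesis using seq_encode_bounds r_def by metis
qed

text \<open>A uniform variable independent of \<open>p1\<close> drives the conditional quantile
  function of \<open>p2\<close> at the middle coordinate. The result \<open>w\<close> is the third
  coordinate, and the glued triple lives on \<open>p1 \<Otimes>\<^sub>M unit_unif\<close>.\<close>

lemma coupling_gluing:
  assumes p1: "p1 \<in> couplings \<rho> \<eta>" and p2: "p2 \<in> couplings \<eta> \<zeta>"
  obtains M :: "((real \<times> real) \<times> real) measure" and w where "prob_space M"
    "fst \<in> M \<rightarrow>\<^sub>M borel" "w \<in> M \<rightarrow>\<^sub>M borel"
    "p1 = distr M borel fst" "p2 = distr M borel (\<lambda>x. (snd (fst x), w x))"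
proof -
  interpret p1: prob_space p1 using p1 by (simp add: couplings_def)
  interpret p2: prob_space p2 using p2 by (simp add: couplings_def)
  interpret U: prob_space unit_unif by (rule prob_space_unit_unif)
  have s1[simp, measurable_cong]: "sets p1 = sets borel" and s2: "sets p2 = sets borel"
    using p1 p2 by (auto simp: couplings_def)
  have eta: "distr p1 borel snd = \<eta>" "distr p2 borel fst = \<eta>"
    using p1 p2 by (auto simp: couplings_def)
  obtain F where F[measurable]: "\<And>n. F n \<in> borel_measurable borel"
    and F2: "p2 = distr (\<eta> \<Otimes>\<^sub>M unit_unif) borel (\<lambda>p. (fst p, cut_real (\<lambda>n. snd p \<le> F n (fst p))))"
    using quantile_representation[OF p2.prob_space_axioms s2, unfolded eta(2)] by blast
  let ?M = "p1 \<Otimes>\<^sub>M unit_unif"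
  interpret M: pair_prob_space p1 unit_unif ..
  have msnd[measurable]: "snd \<in> p1 \<rightarrow>\<^sub>M borel"
    by (simp add: measurable_cong_sets[OF s1 refl] borel_prod[symmetric])
  define w where "w x = cut_real (\<lambda>n. snd x \<le> F n (snd (fst x)))" for x :: "(real \<times> real) \<times> real"
  have w[measurable]: "w \<in> ?M \<rightarrow>\<^sub>M borel" unfolding w_def by measurable
  \<comment> \<open>The middle coordinate has law \<open>\<eta>\<close> and is independent of the
    uniform variable, so the representation of \<open>p2\<close> can be pulled back to the space of
    the triple.\<close>
  have eM: "\<eta> \<Otimes>\<^sub>M unit_unif = distr ?M (borel \<Otimes>\<^sub>M unit_unif) (\<lambda>x. (snd (fst x), snd x))"
  proof -
    have "\<eta> \<Otimes>\<^sub>M unit_unif = distr p1 borel snd \<Otimes>\<^sub>M distr unit_unif unit_unif (\<lambda>x. x)"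
      by (simp add: eta distr_id)
    also have "\<dots> = distr ?M (borel \<Otimes>\<^sub>M unit_unif) (\<lambda>(x, y). (snd x, y))"
      by (rule pair_measure_distr) (auto simp: distr_id intro: U.sigma_finite_measure_axioms)
    finally show ?thesis by (simp add: case_prod_beta')
  qed
  have "p2 = distr ?M borel ((\<lambda>p. (fst p, cut_real (\<lambda>n. snd p \<le> F n (fst p)))) \<circ>
      (\<lambda>x. (snd (fst x), snd x)))"
    unfolding F2 eM borel_prod[symmetric] by (rule distr_distr) measurable
  then have "p2 = distr ?M borel (\<lambda>x. (snd (fst x), w x))" by (simp add: o_def w_def)
  moreover have "p1 = distr ?M borel fst"
    using U.distr_pair_fst[of p1] distr_cong[OF refl s1, of ?M fst fst] by simp
  ultimately show thesis
    by (intro that[of ?M w] M.prob_space_axioms w) auto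
qed

section \<open>Pointwise properties of the fused Gromov--Wasserstein discrepancy\<close>

definition fgw_cost :: "real \<Rightarrow> (real \<Rightarrow> real \<Rightarrow> real) \<Rightarrow> (real \<times> real) measure \<Rightarrow> ennreal" where
  "fgw_cost \<beta> d1 \<pi> =
     ennreal (1 - \<beta>) * (\<integral>\<^sup>+ p. ennreal (d1 (fst p) (snd p)) \<partial>\<pi>)
   + ennreal \<beta> * (\<integral>\<^sup>+ p. \<integral>\<^sup>+ q. ennreal ((d1 (fst p) (fst q) - d1 (snd p) (snd q))\<^sup>2) \<partial>\<pi> \<partial>\<pi>)"

lemma D_fgw_eq: "D_fgw \<beta> d1 \<rho> \<eta> = (INF \<pi> \<in> couplings \<rho> \<eta>. fgw_cost \<beta> d1 \<pi>)"
  by (simp add: D_fgw_def fgw_cost_def)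

lemma measurable_binary_comp:
  assumes d: "(\<lambda>p. d (fst p) (snd p)) \<in> borel_measurable (borel :: (real \<times> real) measure)"
    and [measurable]: "f \<in> borel_measurable M" "g \<in> borel_measurable M"
  shows "(\<lambda>x. d (f x) (g x) :: real) \<in> borel_measurable M"
proof -
  have "(\<lambda>x. (f x, g x)) \<in> M \<rightarrow>\<^sub>M borel" unfolding borel_prod[symmetric] by measurable
  from measurable_comp[OF this d] show ?thesis by (simp add: o_def)
qed

text \<open>Moves the costs of several couplings onto one probability space, where their integrands
  can be compared pointwise.\<close>

lemma fgw_cost_distr:
  assumes d: "(\<lambda>p. d1 (fst p) (snd p)) \<in> borel_measurable (borel :: (real \<times> real) measure)"
    and M: "prob_space M" and X: "f \<in> borel_measurable M" "g \<in> borel_measurable M"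
  shows "fgw_cost \<beta> d1 (distr M borel (\<lambda>x. (f x, g x))) =
     ennreal (1 - \<beta>) * (\<integral>\<^sup>+ x. ennreal (d1 (f x) (g x)) \<partial>M)
   + ennreal \<beta> * (\<integral>\<^sup>+ x. \<integral>\<^sup>+ y. ennreal ((d1 (f x) (f y) - d1 (g x) (g y))\<^sup>2) \<partial>M \<partial>M)"
proof -
  interpret prob_space M by fact
  note [measurable] = X measurable_binary_comp[OF d]
  have [measurable]: "(\<lambda>x. (f x, g x)) \<in> M \<rightarrow>\<^sub>M borel \<Otimes>\<^sub>M borel" by measurable
  show ?thesis
    unfolding fgw_cost_def borel_prod[symmetric]
    by (simp add: nn_integral_distr)
qed

lemma square_diff_triangle: "(a - c)\<^sup>2 \<le> 2 * (a - b)\<^sup>2 + 2 * (b - c :: real)\<^sup>2"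
proof -
  have "2 * (a - b)\<^sup>2 + 2 * (b - c)\<^sup>2 - (a - c)\<^sup>2 = (a - 2 * b + c)\<^sup>2"
    by (simp add: power2_eq_square algebra_simps)
  then show ?thesis using zero_le_power2[of "a - 2 * b + c"] by linarith
qed

lemma D_fgw_triangle:
  assumes d: "(\<lambda>p. d1 (fst p) (snd p)) \<in> borel_measurable (borel :: (real \<times> real) measure)"
    and nonneg: "\<And>x y. 0 \<le> d1 x y" and C: "\<And>x y z. d1 x z \<le> C * (d1 x y + d1 y z)"
  shows "D_fgw \<beta> d1 \<rho> \<zeta> \<le> ennreal (max C 2) * (D_fgw \<beta> d1 \<rho> \<eta> + D_fgw \<beta> d1 \<eta> \<zeta>)"
proof -
  have main: "D_fgw \<beta> d1 \<rho> \<zeta> \<le> ennreal (max C 2) * (fgw_cost \<beta> d1 p1 + fgw_cost \<beta> d1 p2)"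
    if p1: "p1 \<in> couplings \<rho> \<eta>" and p2: "p2 \<in> couplings \<eta> \<zeta>" for p1 p2
  proof -
    obtain M :: "((real \<times> real) \<times> real) measure" and w where M: "prob_space M"
      and mf: "fst \<in> M \<rightarrow>\<^sub>M borel" and w[measurable]: "w \<in> M \<rightarrow>\<^sub>M borel"
      and p1M: "p1 = distr M borel fst" and p2M: "p2 = distr M borel (\<lambda>x. (snd (fst x), w x))"
      by (rule coupling_gluing[OF p1 p2])
    interpret prob_space M by fact
    define s where "s x = fst (fst x)" for x :: "(real \<times> real) \<times> real"
    define t where "t x = snd (fst x)" for x :: "(real \<times> real) \<times> real"
    have mf'[measurable]: "fst \<in> M \<rightarrow>\<^sub>M borel \<Otimes>\<^sub>M borel" using mf by (simp add: borel_prod)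
    have s[measurable]: "s \<in> borel_measurable M" and t[measurable]: "t \<in> borel_measurable M"
      unfolding s_def t_def by measurable
    have p1': "p1 = distr M borel (\<lambda>x. (s x, t x))" and p2': "p2 = distr M borel (\<lambda>x. (t x, w x))"
      using p1M p2M by (simp_all add: s_def t_def)
    note [measurable] = measurable_binary_comp[OF d]
    \<comment> \<open>The competitor couples the two outer coordinates of the glued triple.\<close>
    let ?p = "distr M borel (\<lambda>x. (s x, w x))"
    have marg: "distr (distr M borel (\<lambda>x. (f x, g x))) borel fst = distr M borel f"
        "distr (distr M borel (\<lambda>x. (f x, g x))) borel snd = distr M borel g"
      if [measurable]: "f \<in> borel_measurable M" "g \<in> borel_measurable M" for f g :: "_ \<Rightarrow> real"
      unfolding borel_prod[symmetric] by (subst distr_distr; simp add: o_def)+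
    have "?p \<in> couplings \<rho> \<zeta>"
    proof -
      have "(\<lambda>x. (s x, w x)) \<in> M \<rightarrow>\<^sub>M borel" unfolding borel_prod[symmetric] by measurable
      then have "prob_space ?p" by (rule prob_space_distr)
      moreover have "distr ?p borel fst = \<rho>" using p1 marg[OF s w] marg[OF s t]
        by (simp add: couplings_def p1')
      moreover have "distr ?p borel snd = \<zeta>" using p2 marg[OF s w] marg[OF t w]
        by (simp add: couplings_def p2')
      ultimately show ?thesis by (simp add: couplings_def)
    qed
    then have "D_fgw \<beta> d1 \<rho> \<zeta> \<le> fgw_cost \<beta> d1 ?p" unfolding D_fgw_eq by (rule INF_lower)
    also have "\<dots> \<le> ennreal (max C 2) * (fgw_cost \<beta> d1 p1 + fgw_cost \<beta> d1 p2)"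
    proof -
      define A where "A f g = (\<integral>\<^sup>+ x. ennreal (d1 (f x) (g x)) \<partial>M)" for f g
      define B where "B f g = (\<integral>\<^sup>+ x. \<integral>\<^sup>+ y. ennreal ((d1 (f x) (f y) - d1 (g x) (g y))\<^sup>2) \<partial>M \<partial>M)" for f g
      have cost: "fgw_cost \<beta> d1 (distr M borel (\<lambda>x. (f x, g x))) = ennreal (1 - \<beta>) * A f g + ennreal \<beta> * B f g"
        if "f \<in> borel_measurable M" "g \<in> borel_measurable M" for f g
        unfolding A_def B_def by (rule fgw_cost_distr[OF d M that])
      have "A s w \<le> (\<integral>\<^sup>+ x. ennreal (max C 2) * (ennreal (d1 (s x) (t x)) + ennreal (d1 (t x) (w x))) \<partial>M)"
        unfolding A_def
      proof (rule nn_integral_mono)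
        fix x
        \<comment> \<open>\<open>C\<close> may be enlarged to \<open>max C 2\<close> because the
          bracket is non-negative; the quadratic part needs the factor 2, so one constant covers
          both.\<close>
        have "d1 (s x) (w x) \<le> max C 2 * (d1 (s x) (t x) + d1 (t x) (w x))"
          by (rule order_trans[OF C mult_right_mono]) (auto intro: add_nonneg_nonneg nonneg)
        then show "ennreal (d1 (s x) (w x)) \<le> ennreal (max C 2) * (ennreal (d1 (s x) (t x)) + ennreal (d1 (t x) (w x)))"
          using nonneg by (simp add: ennreal_mult[symmetric] ennreal_plus[symmetric] ennreal_leI del: ennreal_plus)
      qed
      also have "\<dots> = ennreal (max C 2) * (A s t + A t w)"
        unfolding A_def by (subst nn_integral_cmult, measurable) (subst nn_integral_add; measurable)
      finally have le1: "A s w \<le> ennreal (max C 2) * (A s t + A t w)" .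
      have "B s w \<le> (\<integral>\<^sup>+ x. \<integral>\<^sup>+ y. ennreal (max C 2) * (ennreal ((d1 (s x) (s y) - d1 (t x) (t y))\<^sup>2) +
          ennreal ((d1 (t x) (t y) - d1 (w x) (w y))\<^sup>2)) \<partial>M \<partial>M)"
        unfolding B_def
      proof (intro nn_integral_mono)
        fix x y
        have "(d1 (s x) (s y) - d1 (w x) (w y))\<^sup>2 \<le>
            2 * ((d1 (s x) (s y) - d1 (t x) (t y))\<^sup>2 + (d1 (t x) (t y) - d1 (w x) (w y))\<^sup>2)"
          using square_diff_triangle[of "d1 (s x) (s y)" "d1 (w x) (w y)" "d1 (t x) (t y)"] by simp
        also have "\<dots> \<le> max C 2 * ((d1 (s x) (s y) - d1 (t x) (t y))\<^sup>2 + (d1 (t x) (t y) - d1 (w x) (w y))\<^sup>2)"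
          by (rule mult_right_mono) auto
        finally show "ennreal ((d1 (s x) (s y) - d1 (w x) (w y))\<^sup>2) \<le> ennreal (max C 2) *
            (ennreal ((d1 (s x) (s y) - d1 (t x) (t y))\<^sup>2) + ennreal ((d1 (t x) (t y) - d1 (w x) (w y))\<^sup>2))"
          by (simp add: ennreal_mult[symmetric] ennreal_plus[symmetric] ennreal_leI del: ennreal_plus)
      qed
      also have "\<dots> = ennreal (max C 2) * (B s t + B t w)"
        unfolding B_def by (simp add: nn_integral_cmult nn_integral_add)
      finally have le2: "B s w \<le> ennreal (max C 2) * (B s t + B t w)" .
      have "fgw_cost \<beta> d1 ?p \<le> ennreal (1 - \<beta>) * (ennreal (max C 2) * (A s t + A t w)) +
          ennreal \<beta> * (ennreal (max C 2) * (B s t + B t w))"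
        unfolding cost[OF s w] by (intro add_mono mult_left_mono le1 le2) auto
      also have "\<dots> = ennreal (max C 2) * (fgw_cost \<beta> d1 p1 + fgw_cost \<beta> d1 p2)"
        unfolding p1' p2' cost[OF s t] cost[OF t w] by (simp add: algebra_simps)
      finally show ?thesis .
    qed
    finally show ?thesis .
  qed
  define K where "K = max C 2"
  have K: "0 < K" by (simp add: K_def)
  let ?a = "D_fgw \<beta> d1 \<rho> \<eta>" and ?b = "D_fgw \<beta> d1 \<eta> \<zeta>"
  have "D_fgw \<beta> d1 \<rho> \<zeta> \<le> ennreal K * (?a + ?b)"
  proof (rule ennreal_le_epsilon)
    \<comment> \<open>Nearly optimal couplings replace minimisers. Each is allowed an excess of
      \<open>e / (2 * K)\<close>, so that after multiplication by \<open>K\<close> the two excesses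
      add up to \<open>e\<close>.\<close>
    fix e :: real assume fin: "ennreal K * (?a + ?b) < top" and e: "0 < e"
    have "?a \<noteq> \<infinity>" "?b \<noteq> \<infinity>" using fin K by (auto simp: ennreal_mult_eq_top_iff)
    moreover have pos: "0 < e / (2 * K)" using e K by simp
    ultimately obtain p1 p2 where p: "p1 \<in> couplings \<rho> \<eta>" "p2 \<in> couplings \<eta> \<zeta>"
        "fgw_cost \<beta> d1 p1 < ?a + ennreal (e / (2 * K))" "fgw_cost \<beta> d1 p2 < ?b + ennreal (e / (2 * K))"
      using INF_approx_ennreal[OF pos D_fgw_eq] by meson
    have "D_fgw \<beta> d1 \<rho> \<zeta> \<le> ennreal K * (fgw_cost \<beta> d1 p1 + fgw_cost \<beta> d1 p2)"
      unfolding K_def by (rule main[OF p(1,2)])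
    also have "\<dots> \<le> ennreal K * ((?a + ennreal (e / (2 * K))) + (?b + ennreal (e / (2 * K))))"
      using p(3,4) by (intro mult_left_mono add_mono) auto
    also have "\<dots> = ennreal K * (?a + ?b) + ennreal K * (ennreal (e / (2 * K)) + ennreal (e / (2 * K)))"
      by (simp add: algebra_simps)
    also have "ennreal K * (ennreal (e / (2 * K)) + ennreal (e / (2 * K))) = ennreal e"
      using K e by (simp add: ennreal_mult[symmetric] ennreal_plus[symmetric] del: ennreal_plus)
    finally show "D_fgw \<beta> d1 \<rho> \<zeta> \<le> ennreal K * (?a + ?b) + ennreal e" .
  qed
  then show ?thesis by (simp add: K_def)
qed

text \<open>Swapping the coordinates turns couplings one way into couplings the other way at the
  same cost, by symmetry of \<open>d1\<close> and of the squared difference.\<close>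

lemma D_fgw_commute:
  assumes d: "(\<lambda>p. d1 (fst p) (snd p)) \<in> borel_measurable (borel :: (real \<times> real) measure)"
    and sym: "\<And>x y. d1 x y = d1 y x"
  shows "D_fgw \<beta> d1 \<rho> \<eta> = D_fgw \<beta> d1 \<eta> \<rho>"
proof -
  have le: "D_fgw \<beta> d1 \<rho> \<eta> \<le> fgw_cost \<beta> d1 \<pi>" if pi: "\<pi> \<in> couplings \<eta> \<rho>" for \<rho> \<eta> \<pi>
  proof -
    interpret prob_space \<pi> using pi by (simp add: couplings_def)
    have [measurable_cong]: "sets \<pi> = sets (borel \<Otimes>\<^sub>M borel)"
      using pi unfolding couplings_def borel_prod by blast
    have f: "fst \<in> borel_measurable \<pi>" and g: "snd \<in> borel_measurable \<pi>" by measurable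
    have m: "(\<lambda>x. (snd x, fst x)) \<in> \<pi> \<rightarrow>\<^sub>M borel" unfolding borel_prod[symmetric] by measurable
    have swap: "distr \<pi> borel (\<lambda>x. (snd x, fst x)) \<in> couplings \<rho> \<eta>"
      using pi prob_space_distr[OF m] unfolding couplings_def borel_prod[symmetric]
      by (auto simp: distr_distr o_def)
    have "fgw_cost \<beta> d1 (distr \<pi> borel (\<lambda>x. (snd x, fst x))) = fgw_cost \<beta> d1 \<pi>"
    proof -
      have "d1 (snd x) (fst x) = d1 (fst x) (snd x)" for x by (rule sym)
      moreover have "(d1 (snd x) (snd y) - d1 (fst x) (fst y))\<^sup>2 = (d1 (fst x) (fst y) - d1 (snd x) (snd y))\<^sup>2" for x y
        by (rule power2_commute)
      ultimately show ?thesis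
        by (simp only: fgw_cost_distr[OF d prob_space_axioms g f] fgw_cost_def[of _ _ \<pi>])
    qed
    then show ?thesis unfolding D_fgw_eq using INF_lower[OF swap, of "fgw_cost \<beta> d1"] by simp
  qed
  show ?thesis
    by (intro antisym; subst (2) D_fgw_eq; intro INF_greatest le)
qed

section \<open>Measurability in the projection direction\<close>

text \<open>Continuity from below carries equality from closed rational half-lines to open
  half-lines, an intersection-stable generator. Equality of marginals thus becomes countably many
  equations.\<close>

lemma measure_eqI_atMost_rat:
  fixes M N :: "real measure"
  assumes sets: "sets M = sets borel" "sets N = sets borel" and fin: "finite_measure M"
    and eq: "\<And>n. emeasure M {..rat_enum n} = emeasure N {..rat_enum n}"
  shows "M = N"
proof -
  interpret finite_measure M by fact
  let ?E = "range (\<lambda>a :: real. {..<a})"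
  have "eucl_less x a \<longleftrightarrow> x < a" for x a :: real by (simp add: eucl_less_def)
  then have bor: "sets borel = sigma_sets UNIV ?E"
    by (subst borel_eq_lessThan) (simp add: lessThan_def)
  show ?thesis
  proof (rule measure_eqI_generator_eq[of ?E UNIV M N "\<lambda>i. {..<real i}"])
    have "{..<a} \<inter> {..<b} = {..<min a b}" for a b :: real by auto
    then show "Int_stable ?E" by (auto simp: Int_stable_def)
    fix X assume "X \<in> ?E"
    then obtain a where X: "X = {..<a}" by auto
    obtain k where k: "incseq (\<lambda>i. rat_enum (k i))" "\<And>i. rat_enum (k i) < a"
        "\<And>x. x < a \<Longrightarrow> \<exists>i. x \<le> rat_enum (k i)"
      using rat_enum_incseq_below[of a] by metis
    have "X = (\<Union>i. {..rat_enum (k i)})" using k(2,3) X by (auto intro: le_less_trans)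
    moreover have "emeasure L (\<Union>i. {..rat_enum (k i)}) = (SUP i. emeasure L {..rat_enum (k i)})"
      if "sets L = sets borel" for L :: "real measure"
      using k(1) that by (intro SUP_emeasure_incseq[symmetric]) (auto simp: incseq_def intro: order_trans)
    ultimately show "emeasure M X = emeasure N X" using sets by (simp add: eq)
  next
    show "(\<Union>i. {..<real i}) = UNIV" using reals_Archimedean2 by auto
  qed (auto simp: sets bor)
qed

section \<open>Borel dependence on the code and on the direction\<close>

lemma measurable_fst_coded_sample[measurable (raw)]:
  assumes [measurable]: "f \<in> borel_measurable M" "g \<in> borel_measurable M"
  shows "(\<lambda>x. fst (coded_sample (f x) (g x))) \<in> borel_measurable M"
  unfolding coded_sample_def Let_def fst_conv by measurable

lemma measurable_snd_coded_sample[measurable (raw)]: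
  assumes [measurable]: "f \<in> borel_measurable M" "g \<in> borel_measurable M"
  shows "(\<lambda>x. snd (coded_sample (f x) (g x))) \<in> borel_measurable M"
  unfolding coded_sample_def Let_def snd_conv by measurable

lemma coded_measure_eq:
  "coded_measure r = distr unit_unif borel (\<lambda>u. (fst (coded_sample r u), snd (coded_sample r u)))"
  by (simp add: coded_measure_def)

lemma prob_space_coded_measure: "prob_space (coded_measure r)"
  unfolding coded_measure_def
  by (rule prob_space.prob_space_distr[OF prob_space_unit_unif measurable_coded_sample'])

text \<open>Puts the marginal constraints into a form visibly Borel in \<open>(\<theta>, r)\<close>:
  countably many equations between integrals, one side depending on \<open>r\<close> and the other
  on \<open>\<theta>\<close>.\<close>

lemma coded_measure_couplings_iff:
  fixes \<mu> \<nu> :: "'a::euclidean_space measure"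
  assumes mu: "prob_space \<mu>" "sets \<mu> = sets borel" and nu: "prob_space \<nu>" "sets \<nu> = sets borel"
  shows "coded_measure r \<in> couplings (proj_push \<theta> \<mu>) (proj_push \<theta> \<nu>) \<longleftrightarrow>
    (\<forall>n. (\<integral>\<^sup>+u. indicator {..rat_enum n} (fst (coded_sample r u)) \<partial>unit_unif) =
           (\<integral>\<^sup>+x. indicator {..rat_enum n} (\<theta> \<bullet> x) \<partial>\<mu>) \<and>
         (\<integral>\<^sup>+u. indicator {..rat_enum n} (snd (coded_sample r u)) \<partial>unit_unif) =
           (\<integral>\<^sup>+x. indicator {..rat_enum n} (\<theta> \<bullet> x) \<partial>\<nu>))"
proof -
  have eq: "distr M borel f = distr N borel g \<longleftrightarrow>
      (\<forall>n. (\<integral>\<^sup>+x. indicator {..rat_enum n} (f x) \<partial>M) = (\<integral>\<^sup>+x. indicator {..rat_enum n} (g x) \<partial>N))"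
    if M: "prob_space M" and f[measurable]: "f \<in> borel_measurable M" and g[measurable]: "g \<in> borel_measurable N"
    for M :: "real measure" and N :: "'a measure" and f g
  proof -
    have *: "(\<integral>\<^sup>+x. indicator {..rat_enum n} (f x) \<partial>M) = emeasure (distr M borel f) {..rat_enum n}" for n
      by (subst nn_integral_indicator[symmetric], simp, subst nn_integral_distr) auto
    have **: "(\<integral>\<^sup>+x. indicator {..rat_enum n} (g x) \<partial>N) = emeasure (distr N borel g) {..rat_enum n}" for n
      by (subst nn_integral_indicator[symmetric], simp, subst nn_integral_distr) auto
    show ?thesis
      unfolding * ** using measure_eqI_atMost_rat[of "distr M borel f" "distr N borel g"]
        prob_space.finite_measure[OF prob_space.prob_space_distr[OF M f]] by auto
  qed
  have [measurable_cong]: "sets \<mu> = sets borel" "sets \<nu> = sets borel" by fact+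
  have "distr (coded_measure r) borel fst = distr unit_unif borel (\<lambda>u. fst (coded_sample r u))"
       "distr (coded_measure r) borel snd = distr unit_unif borel (\<lambda>u. snd (coded_sample r u))"
    unfolding coded_measure_def
    by (subst distr_distr[OF _ measurable_coded_sample'];
        simp add: o_def borel_measurable_continuous_onI continuous_on_fst continuous_on_snd)+
  then show ?thesis
    unfolding couplings_def proj_push_def
    by (simp add: prob_space_coded_measure eq[OF prob_space_unit_unif] all_conj_distrib)
       (simp add: coded_measure_def)
qed

text \<open>Since every coupling has a code, the infimum over measures becomes one over reals in a
  compact interval.\<close>

lemma D_fgw_eq_coded:
  "D_fgw \<beta> d1 \<rho> \<eta> = (INF r\<in>{r\<in>{0..2}. coded_measure r \<in> couplings \<rho> \<eta>}. fgw_cost \<beta> d1 (coded_measure r))"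
proof -
  have "couplings \<rho> \<eta> = coded_measure ` {r\<in>{0..2}. coded_measure r \<in> couplings \<rho> \<eta>}"
  proof (intro equalityI subsetI)
    fix \<pi> assume pi: "\<pi> \<in> couplings \<rho> \<eta>"
    then obtain r where "r \<in> {0..2}" "coded_measure r = \<pi>"
      using ex_coded_measure[of \<pi>] by (auto simp: couplings_def)
    with pi show "\<pi> \<in> coded_measure ` {r\<in>{0..2}. coded_measure r \<in> couplings \<rho> \<eta>}" by blast
  qed auto
  then have "fgw_cost \<beta> d1 ` couplings \<rho> \<eta> =
      (\<lambda>r. fgw_cost \<beta> d1 (coded_measure r)) ` {r\<in>{0..2}. coded_measure r \<in> couplings \<rho> \<eta>}"
    by (rule ssubst[where P="\<lambda>X. fgw_cost \<beta> d1 ` X = _"]) (simp only: image_image)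
  then show ?thesis unfolding D_fgw_eq by (rule arg_cong)
qed

lemma measurable_D_fgw_proj_push:
  fixes \<mu> \<nu> :: "'a::euclidean_space measure"
  assumes d: "(\<lambda>p. d1 (fst p) (snd p)) \<in> borel_measurable (borel :: (real \<times> real) measure)"
    and mu: "prob_space \<mu>" "sets \<mu> = sets borel" and nu: "prob_space \<nu>" "sets \<nu> = sets borel"
    and M: "finite_measure M" "sets M = sets borel"
  shows "(\<lambda>\<theta>. D_fgw \<beta> d1 (proj_push \<theta> \<mu>) (proj_push \<theta> \<nu>)) \<in> borel_measurable (completion M)"
proof (rule borel_measurableI_less)
  fix a :: ennreal
  interpret mu: prob_space \<mu> by fact
  interpret nu: prob_space \<nu> by fact
  interpret U: prob_space unit_unif by (rule prob_space_unit_unif)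
  have [measurable_cong]: "sets \<mu> = sets borel" "sets \<nu> = sets borel" by fact+
  note [measurable] = measurable_binary_comp[OF d]
  have cost[measurable]: "(\<lambda>r. fgw_cost \<beta> d1 (coded_measure r)) \<in> borel_measurable borel"
    unfolding coded_measure_eq
    by (subst fgw_cost_distr[OF d prob_space_unit_unif]) measurable
  let ?B = "{p :: 'a \<times> real. snd p \<in> {0..2} \<and>
      coded_measure (snd p) \<in> couplings (proj_push (fst p) \<mu>) (proj_push (fst p) \<nu>) \<and>
      fgw_cost \<beta> d1 (coded_measure (snd p)) < a}"
  have "Measurable.pred (borel \<Otimes>\<^sub>M borel) (\<lambda>p :: 'a \<times> real. snd p \<in> {0..2} \<and>
      coded_measure (snd p) \<in> couplings (proj_push (fst p) \<mu>) (proj_push (fst p) \<nu>) \<and>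
      fgw_cost \<beta> d1 (coded_measure (snd p)) < a)"
    unfolding coded_measure_couplings_iff[OF mu nu] by measurable
  then have "?B \<in> sets borel" by (simp add: borel_prod pred_def)
  then have "fst ` ?B \<in> sets (completion M)" by (intro measurable_projection M) auto
  \<comment> \<open>An infimum is below \<open>a\<close> exactly when some admissible code has cost
    below \<open>a\<close>; hence the strict sublevel set is a projection, whether or not a
    minimiser exists.\<close>
  moreover have "{\<theta> \<in> space (completion M). D_fgw \<beta> d1 (proj_push \<theta> \<mu>) (proj_push \<theta> \<nu>) < a} = fst ` ?B"
    using sets_eq_imp_space_eq[OF M(2)] unfolding D_fgw_eq_coded INF_less_iff by (force simp: image_iff)
  ultimately show "{\<theta> \<in> space (completion M). D_fgw \<beta> d1 (proj_push \<theta> \<mu>) (proj_push \<theta> \<nu>) < a} \<in> sets (completion M)"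
    by simp
qed

section \<open>Integration against the mixtures on the sphere\<close>

lemma finite_measure_sphere_unif: "finite_measure (sphere_unif :: 'a::euclidean_space measure)"
proof -
  have "prob_space (uniform_measure lborel (ball (0 :: 'a) 1))"
    using content_ball_pos[of 1 "0 :: 'a"] emeasure_lborel_ball_finite[of "0 :: 'a" 1]
    by (intro prob_space_uniform_measure) (auto simp: measure_def)
  then interpret prob_space "uniform_measure lborel (ball (0 :: 'a) 1)" .
  show ?thesis unfolding sphere_unif_def
    by (rule finite_measure_distr) measurable
qed

lemma sets_sphere_unif[simp, measurable_cong]: "sets sphere_unif = sets borel"
  by (simp add: sphere_unif_def)

lemma AE_movmf:
  assumes "AE x in sphere_unif. Q x"
  shows "AE x in movmf k \<kappa> \<alpha> \<epsilon>. Q x"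
proof -
  have "(\<lambda>x. ennreal (\<Sum>i<k. \<alpha> i * vmf_density (\<kappa> i) (\<epsilon> i) x)) \<in> borel_measurable sphere_unif"
    unfolding vmf_density_def by measurable
  from AE_density[OF this] assms show ?thesis unfolding movmf_def by auto
qed

text \<open>A function measurable for the completion agrees almost everywhere with a Borel one. All
  mixtures have densities with respect to \<open>sphere_unif\<close>, so a single \<open>g\<close>
  serves for every choice of parameters.\<close>

lemma ex_measurable_D_fgw:
  fixes \<mu> \<nu> :: "'a::euclidean_space measure"
  assumes d: "(\<lambda>p. d1 (fst p) (snd p)) \<in> borel_measurable (borel :: (real \<times> real) measure)"
    and mu: "\<mu> \<in> prob_fin_moments" and nu: "\<nu> \<in> prob_fin_moments"
  shows "\<exists>g\<in>borel_measurable borel. \<forall>k \<kappa> \<alpha> \<epsilon>. AE \<theta> in movmf k \<kappa> \<alpha> \<epsilon>.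
    D_fgw \<beta> d1 (proj_push \<theta> \<mu>) (proj_push \<theta> \<nu>) = g \<theta>"
proof -
  obtain g where g: "g \<in> borel_measurable sphere_unif"
    "AE \<theta> in sphere_unif. D_fgw \<beta> d1 (proj_push \<theta> \<mu>) (proj_push \<theta> \<nu>) = g \<theta>"
    using completion_ex_borel_measurable[OF measurable_D_fgw_proj_push[OF d _ _ _ _
        finite_measure_sphere_unif sets_sphere_unif]] mu nu
    unfolding prob_fin_moments_def by blast
  show ?thesis
    using g AE_movmf by (intro bexI[of _ g]) (auto simp: measurable_cong_sets[OF sets_sphere_unif refl])
qed

text \<open>The constant obtained is \<open>max C 2\<close>, where \<open>C\<close> is the constant
  of \<open>d1\<close>. Values lie in \<open>ennreal\<close>, so non-negativity is immediate and
  infinite values are included.\<close>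

theorem theorem4:
  fixes \<beta> :: real and d1 :: "real \<Rightarrow> real \<Rightarrow> real" and k :: nat
    and \<kappa> \<alpha> :: "nat \<Rightarrow> real"
  assumes dim: "DIM('a::euclidean_space) \<ge> 2"
    and k: "k \<ge> 1"
    and beta: "0 \<le> \<beta>" "\<beta> \<le> 1"
    and kappa: "\<forall>i<k. \<kappa> i > 0"
    and alpha: "\<forall>i<k. \<alpha> i \<ge> 0" "(\<Sum>i<k. \<alpha> i) = 1"
    and d1: "pseudo_metric d1"
    and d1_meas: "(\<lambda>p. d1 (fst p) (snd p)) \<in> borel_measurable borel"
  shows "(\<forall>\<mu>\<in>(prob_fin_moments :: 'a measure set). \<forall>\<nu>\<in>prob_fin_moments.
            0 \<le> MSSFG \<beta> d1 k \<kappa> \<alpha> \<mu> \<nu> \<and> MSSFG \<beta> d1 k \<kappa> \<alpha> \<mu> \<nu> = MSSFG \<beta> d1 k \<kappa> \<alpha> \<nu> \<mu>)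
       \<and> (\<exists>C'>0. \<forall>\<mu>\<in>(prob_fin_moments :: 'a measure set). \<forall>\<nu>\<in>prob_fin_moments. \<forall>\<xi>\<in>prob_fin_moments.
            MSSFG \<beta> d1 k \<kappa> \<alpha> \<mu> \<xi> \<le> ennreal C' * (MSSFG \<beta> d1 k \<kappa> \<alpha> \<mu> \<nu> + MSSFG \<beta> d1 k \<kappa> \<alpha> \<nu> \<xi>))"
proof -
  have nonneg: "\<And>x y. 0 \<le> d1 x y" and sym: "\<And>x y. d1 x y = d1 y x"
    using d1 by (auto simp: pseudo_metric_def)
  obtain C where C: "0 < C" "\<And>x y z. d1 x z \<le> C * (d1 x y + d1 y z)"
    using d1 unfolding pseudo_metric_def by blast
  let ?D = "\<lambda>\<mu> \<nu> \<theta> :: 'a. D_fgw \<beta> d1 (proj_push \<theta> \<mu>) (proj_push \<theta> \<nu>)"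
  have commute: "MSSFG \<beta> d1 k \<kappa> \<alpha> \<mu> \<nu> = MSSFG \<beta> d1 k \<kappa> \<alpha> \<nu> \<mu>" for \<mu> \<nu> :: "'a measure"
    unfolding MSSFG_def by (simp add: D_fgw_commute[OF d1_meas sym, of _ "proj_push _ \<mu>"])
  have tri: "MSSFG \<beta> d1 k \<kappa> \<alpha> \<mu> \<xi> \<le>
      ennreal (max C 2) * (MSSFG \<beta> d1 k \<kappa> \<alpha> \<mu> \<nu> + MSSFG \<beta> d1 k \<kappa> \<alpha> \<nu> \<xi>)"
    if mem: "\<mu> \<in> prob_fin_moments" "\<nu> \<in> prob_fin_moments" "\<xi> \<in> prob_fin_moments" for \<mu> \<nu> \<xi> :: "'a measure"
  proof -
    obtain g where gm: "g \<in> borel_measurable borel"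
      and g: "\<And>k \<kappa> \<alpha> \<epsilon>. AE \<theta> in movmf k \<kappa> \<alpha> \<epsilon>. ?D \<mu> \<nu> \<theta> = g \<theta>"
      using ex_measurable_D_fgw[OF d1_meas mem(1,2), of \<beta>] by blast
    obtain h where hm: "h \<in> borel_measurable borel"
      and h: "\<And>k \<kappa> \<alpha> \<epsilon>. AE \<theta> in movmf k \<kappa> \<alpha> \<epsilon>. ?D \<nu> \<xi> \<theta> = h \<theta>"
      using ex_measurable_D_fgw[OF d1_meas mem(2,3), of \<beta>] by blast
    show ?thesis
      unfolding MSSFG_def[of _ _ _ _ _ \<mu> \<xi>]
    proof (rule SUP_least)
      fix \<epsilon> :: "nat \<Rightarrow> 'a" assume \<epsilon>: "\<epsilon> \<in> {\<epsilon>. \<forall>i<k. \<epsilon> i \<in> sphere 0 1}"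
      let ?m = "movmf k \<kappa> \<alpha> \<epsilon>"
      have [measurable_cong]: "sets ?m = sets borel" by (simp add: movmf_def)
      note [measurable] = gm hm
      have "(\<integral>\<^sup>+\<theta>. ?D \<mu> \<xi> \<theta> \<partial>?m) \<le> (\<integral>\<^sup>+\<theta>. ennreal (max C 2) * (?D \<mu> \<nu> \<theta> + ?D \<nu> \<xi> \<theta>) \<partial>?m)"
        by (intro nn_integral_mono D_fgw_triangle[OF d1_meas nonneg C(2)])
      \<comment> \<open>The Borel versions \<open>g\<close> and \<open>h\<close> enter just before
        the integral is split, which needs measurability, and are exchanged back afterwards.\<close>
      also have "\<dots> = (\<integral>\<^sup>+\<theta>. ennreal (max C 2) * (g \<theta> + h \<theta>) \<partial>?m)"
        by (rule nn_integral_cong_AE, use g[of k \<kappa> \<alpha> \<epsilon>] h[of k \<kappa> \<alpha> \<epsilon>] in eventually_elim) simp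
      also have "\<dots> = ennreal (max C 2) * ((\<integral>\<^sup>+\<theta>. g \<theta> \<partial>?m) + (\<integral>\<^sup>+\<theta>. h \<theta> \<partial>?m))"
        by (simp add: nn_integral_cmult nn_integral_add)
      also have "(\<integral>\<^sup>+\<theta>. g \<theta> \<partial>?m) = (\<integral>\<^sup>+\<theta>. ?D \<mu> \<nu> \<theta> \<partial>?m)"
        by (rule nn_integral_cong_AE, use g[of k \<kappa> \<alpha> \<epsilon>] in eventually_elim) simp
      also have "(\<integral>\<^sup>+\<theta>. h \<theta> \<partial>?m) = (\<integral>\<^sup>+\<theta>. ?D \<nu> \<xi> \<theta> \<partial>?m)"
        by (rule nn_integral_cong_AE, use h[of k \<kappa> \<alpha> \<epsilon>] in eventually_elim) simp
      \<comment> \<open>The same \<open>\<epsilon>\<close> is admissible in both suprema on the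
        right.\<close>
      also have "ennreal (max C 2) * ((\<integral>\<^sup>+\<theta>. ?D \<mu> \<nu> \<theta> \<partial>?m) + (\<integral>\<^sup>+\<theta>. ?D \<nu> \<xi> \<theta> \<partial>?m)) \<le>
          ennreal (max C 2) * (MSSFG \<beta> d1 k \<kappa> \<alpha> \<mu> \<nu> + MSSFG \<beta> d1 k \<kappa> \<alpha> \<nu> \<xi>)"
        unfolding MSSFG_def using \<epsilon> by (intro mult_left_mono add_mono SUP_upper) auto
      finally show "(\<integral>\<^sup>+\<theta>. ?D \<mu> \<xi> \<theta> \<partial>?m) \<le>
          ennreal (max C 2) * (MSSFG \<beta> d1 k \<kappa> \<alpha> \<mu> \<nu> + MSSFG \<beta> d1 k \<kappa> \<alpha> \<nu> \<xi>)" .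
    qed
  qed
  show ?thesis
    using commute tri C(1) by (intro conjI ballI exI[of _ "max C 2"]) auto
qed

end
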